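(* Let $n>5$ and $3\le k\le n$. Consider all signed complete graphs $(K_n,U^-)$ where $U$ ranges over the unicyclic subgraphs of $K_n$ with exactly $k$ vertices. If $U$ is such that $(K_n,U^-)$ has maximum index among all of these, then $U$ is isomorphic to the graph consisting of a triangle together with $k-3$ further vertices all adjacent (only) to one and the same vertex of the triangle.
   Context: A unicyclic graph is a connected graph containing exactly one cycle. For a subgraph $H$ of $K_n$, $(K_n,H^-)$ denotes the signed complete graph on $n$ vertices whose negative edges are exactly the edges of $H$ and all other edges positive; its adjacency matrix has entry $-1$ for negative edges, $+1$ for positive edges and $0$ on the diagonal. The index of a signed graph is the largest eigenvalue of its adjacency matrix. *)

theory Defs
  imports "Jordan_Normal_Form.Char_Poly"
begin

definition simple_graph :: "nat set \<Rightarrow> nat set set \<Rightarrow> bool" where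
  "simple_graph V E \<longleftrightarrow> finite V \<and> (\<forall>e\<in>E. \<exists>a b. a \<in> V \<and> b \<in> V \<and> a \<noteq> b \<and> e = {a, b})"

definition subgraph_Kn :: "nat \<Rightarrow> nat set \<Rightarrow> nat set set \<Rightarrow> bool" where
  "subgraph_Kn n V E \<longleftrightarrow> V \<subseteq> {..<n} \<and> simple_graph V E"

definition connected_graph :: "nat set \<Rightarrow> nat set set \<Rightarrow> bool" where
  "connected_graph V E \<longleftrightarrow> (\<forall>u\<in>V. \<forall>v\<in>V. (\<lambda>a b. {a, b} \<in> E)\<^sup>*\<^sup>* u v)"

definition is_cycle :: "nat set set \<Rightarrow> bool" where
  "is_cycle C \<longleftrightarrow> C \<noteq> {} \<and> finite C \<and>
     (\<forall>v\<in>\<Union>C. card {e\<in>C. v \<in> e} = 2) \<and> connected_graph (\<Union>C) C"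

definition unicyclic :: "nat set \<Rightarrow> nat set set \<Rightarrow> bool" where
  "unicyclic V E \<longleftrightarrow> simple_graph V E \<and> connected_graph V E \<and> (\<exists>!C. C \<subseteq> E \<and> is_cycle C)"

definition signed_Kn_adj :: "nat \<Rightarrow> nat set set \<Rightarrow> real mat" where
  "signed_Kn_adj n H = mat n n (\<lambda>(i, j). if i = j then 0 else if {i, j} \<in> H then -1 else 1)"

definition index :: "real mat \<Rightarrow> real" where
  "index A = Max {x. eigenvalue A x}"

definition triangle_pendants :: "nat \<Rightarrow> nat set set" where
  "triangle_pendants k = {{0,1},{1,2},{0,2}} \<union> {{0, i} | i. 3 \<le> i \<and> i < k}"

definition graph_iso :: "nat set \<Rightarrow> nat set set \<Rightarrow> nat set \<Rightarrow> nat set set \<Rightarrow> bool" where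
  "graph_iso V E W F \<longleftrightarrow> (\<exists>f. bij_betw f V W \<and>
     (\<forall>a\<in>V. \<forall>b\<in>V. {a, b} \<in> E \<longleftrightarrow> {f a, f b} \<in> F))"

end

theory Submission
  imports Defs "HOL-Analysis.Function_Topology"
begin

text \<open>
  Let \<open>x\<close> be an eigenvector for the index \<open>m\<close> of the extremal \<open>U\<close>, with nonnegative sum; then
  \<open>x\<close> is nonnegative off \<open>V\<close>. By Rayleigh's principle it suffices to find a graph \<open>H\<close>, a star on
  \<open>V\<close> centred at some \<open>a\<close> plus one edge \<open>bc\<close>, and a vector \<open>y\<close> with \<open>|y| = |x|\<close> whose form for \<open>H\<close>
  is at least that of \<open>x\<close> for \<open>U\<close>: by extremality \<open>y\<close> is then an eigenvector of \<open>H\<close> for \<open>m\<close>,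
  and comparing eigenvector equations identifies \<open>U\<close>.

  If \<open>x\<close> has at most one negative entry on \<open>V\<close>, take \<open>y = x\<close> and \<open>a\<close> minimizing \<open>x\<close>: the weight
  \<open>\<Sum>uv\<in>U. x u * x v\<close> only drops when all vertices are reattached to \<open>a\<close>, keeping one cycle
  edge \<open>bc\<close> that avoids \<open>a\<close>. Otherwise switch at the set \<open>N\<close> of negative entries. All edges from
  \<open>N\<close> to the outside of \<open>V\<close> become negative, and unless \<open>U\<close> is a triangle or a 4-cycle some edge
  \<open>bc\<close> inside \<open>V\<close> avoiding some \<open>a \<in> N\<close> is negative too; so \<open>H\<close>, which after switching at \<open>a\<close> has
  only the negative edges \<open>bc\<close> and \<open>aw\<close> with \<open>w \<notin> V\<close>, is at least as good. The 4-cycle is excluded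
  since there such an \<open>x\<close> forces \<open>m = 3\<close>, whereas every \<open>H\<close> has index greater than 3 for \<open>n > 5\<close>.
\<close>

section \<open>Rayleigh's principle\<close>

definition signed_entry :: "nat set set \<Rightarrow> nat \<Rightarrow> nat \<Rightarrow> real" where
  "signed_entry U i j = (if i = j then 0 else if {i, j} \<in> U then -1 else 1)"

definition quad_form :: "nat \<Rightarrow> (nat \<Rightarrow> nat \<Rightarrow> real) \<Rightarrow> (nat \<Rightarrow> real) \<Rightarrow> real" where
  "quad_form n A x = (\<Sum>i<n. \<Sum>j<n. A i j * x i * x j)"

text \<open>Compactness of the unit sphere. Vectors are functions on all of \<open>nat\<close>, so
  the sphere is cut out of the box \<open>B\<close>, which is compact by Tychonoff.\<close>

lemma quad_form_attains_max_on_sphere: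
  assumes "n > 0"
  obtains x where "(\<Sum>i<n. (x i)\<^sup>2) = 1"
    and "\<And>y. (\<Sum>i<n. (y i)\<^sup>2) = 1 \<Longrightarrow> quad_form n A y \<le> quad_form n A x"
proof -
  define B :: "(nat \<Rightarrow> real) set" where "B = PiE UNIV (\<lambda>_. {-1..1})"
  define T where "T = B \<inter> {x. (\<Sum>i<n. (x i)\<^sup>2) = 1}"
  have "compactin (product_topology (\<lambda>_. euclidean) UNIV) B"
    unfolding B_def by (subst compactin_PiE) auto
  then have "compact B"
    by (simp add: euclidean_product_topology)
  moreover have "closed {x::nat \<Rightarrow> real. (\<Sum>i<n. (x i)\<^sup>2) = 1}"
    by (intro closed_Collect_eq continuous_intros continuous_on_product_coordinates)
  ultimately have "compact T"
    unfolding T_def by (rule compact_Int_closed)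
  moreover have "(\<lambda>i. if i = 0 then 1 else 0) \<in> T"
    using assms by (auto simp: T_def B_def if_distrib[of "\<lambda>x. x\<^sup>2"] cong: if_cong)
  moreover have "continuous_on T (quad_form n A)"
    unfolding quad_form_def
    by (intro continuous_intros continuous_on_subset[OF continuous_on_product_coordinates]) auto
  ultimately obtain x where x: "x \<in> T" "\<forall>y\<in>T. quad_form n A y \<le> quad_form n A x"
    using continuous_attains_sup[of T "quad_form n A"] by blast
  show thesis
  proof (rule that)
    show "(\<Sum>i<n. (x i)\<^sup>2) = 1"
      using x by (simp add: T_def)
    fix y :: "nat \<Rightarrow> real" assume y: "(\<Sum>i<n. (y i)\<^sup>2) = 1"
    \<comment> \<open>Entries from \<open>n\<close> on do not affect the form, so setting them to 0
      moves \<open>y\<close> into the box.\<close>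
    define z where "z i = (if i < n then y i else 0)" for i
    have "\<bar>y i\<bar> \<le> 1" if "i < n" for i
    proof -
      have "(y i)\<^sup>2 \<le> (\<Sum>i<n. (y i)\<^sup>2)"
        using that by (intro member_le_sum) auto
      then show ?thesis
        using y by (simp add: abs_square_le_1)
    qed
    then have "z \<in> B"
      by (auto simp: B_def z_def abs_le_iff)
    then have "z \<in> T"
      using y by (simp add: T_def z_def)
    then have "quad_form n A z \<le> quad_form n A x"
      using x by blast
    moreover have "quad_form n A z = quad_form n A y"
      by (simp add: quad_form_def z_def)
    ultimately show "quad_form n A y \<le> quad_form n A x"
      by simp
  qed
qed

lemma quad_form_eigenvector:
  assumes "\<And>i. i < n \<Longrightarrow> (\<Sum>j<n. A i j * x j) = m * x i"
  shows "quad_form n A x = m * (\<Sum>i<n. (x i)\<^sup>2)"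
proof -
  have "quad_form n A x = (\<Sum>i<n. x i * (\<Sum>j<n. A i j * x j))"
    by (simp add: quad_form_def sum_distrib_left mult_ac)
  also have "\<dots> = (\<Sum>i<n. x i * (m * x i))"
    by (intro sum.cong) (auto simp: assms)
  finally show ?thesis
    by (simp add: sum_distrib_left power2_eq_square mult_ac)
qed

lemma quad_form_scale: "quad_form n A (\<lambda>i. c * x i) = c\<^sup>2 * quad_form n A x"
  by (simp add: quad_form_def sum_distrib_left power2_eq_square mult_ac)

lemma quad_form_add:
  assumes "\<And>i j. A i j = A j i"
  shows "quad_form n A (\<lambda>i. x i + t * z i) =
    quad_form n A x + 2 * t * (\<Sum>i<n. z i * (\<Sum>j<n. A i j * x j)) + t\<^sup>2 * quad_form n A z"
proof -
  have sw: "(\<Sum>i<n. \<Sum>j<n. A i j * x i * z j) = (\<Sum>i<n. \<Sum>j<n. A i j * z i * x j)"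
    by (subst sum.swap) (simp add: assms mult_ac)
  have "quad_form n A (\<lambda>i. x i + t * z i) = (\<Sum>i<n. \<Sum>j<n. A i j * x i * x j
      + t * (A i j * x i * z j) + t * (A i j * z i * x j) + t\<^sup>2 * (A i j * z i * z j))"
    by (simp add: quad_form_def algebra_simps power2_eq_square)
  also have "\<dots> = quad_form n A x + t * (\<Sum>i<n. \<Sum>j<n. A i j * x i * z j)
      + t * (\<Sum>i<n. \<Sum>j<n. A i j * z i * x j) + t\<^sup>2 * quad_form n A z"
    by (simp add: quad_form_def sum.distrib sum_distrib_left)
  finally have "quad_form n A (\<lambda>i. x i + t * z i) = quad_form n A x
      + 2 * t * (\<Sum>i<n. \<Sum>j<n. A i j * z i * x j) + t\<^sup>2 * quad_form n A z"
    unfolding sw by simp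
  moreover have "(\<Sum>i<n. \<Sum>j<n. A i j * z i * x j) = (\<Sum>i<n. z i * (\<Sum>j<n. A i j * x j))"
    by (simp add: sum_distrib_left mult_ac)
  ultimately show ?thesis
    by simp
qed

text \<open>A quadratic in \<open>t\<close> with minimum 0 at \<open>t = 0\<close> has derivative 0
  there.\<close>

lemma linear_coefficient_zero:
  fixes b c :: real
  assumes "\<And>t. 2 * t * b + t\<^sup>2 * c \<ge> 0"
  shows "b = 0"
proof (rule ccontr)
  assume b: "b \<noteq> 0"
  \<comment> \<open>Since \<open>d\<close> exceeds both 0 and \<open>c\<close>, the value at
    \<open>t = - b / d\<close> is negative unless \<open>b = 0\<close>.\<close>
  define d where "d = \<bar>c\<bar> + 1"
  have d: "d > 0" "c < d"
    by (auto simp: d_def)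
  have "0 \<le> 2 * (- b / d) * b + (- b / d)\<^sup>2 * c"
    by (rule assms)
  also have "\<dots> = (b\<^sup>2 / d\<^sup>2) * (c - 2 * d)"
    using d by (simp add: field_simps power2_eq_square)
  also have "\<dots> < 0"
    using b d by (intro mult_pos_neg) auto
  finally show False
    by simp
qed

text \<open>The slack \<open>m |y|\<^sup>2 - y A y\<close> is minimal at \<open>x\<close>, hence stationary there.\<close>

lemma rayleigh_maximizer_eigenvector:
  assumes sym: "\<And>i j. A i j = A j i"
    and ub: "\<And>y. quad_form n A y \<le> m * (\<Sum>i<n. (y i)\<^sup>2)"
    and eq: "quad_form n A x = m * (\<Sum>i<n. (x i)\<^sup>2)"
    and "i < n"
  shows "(\<Sum>j<n. A i j * x j) = m * x i"
proof -
  \<comment> \<open>Perturbing along the unit vector at \<open>i\<close> makes the linear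
    coefficient of the slack, up to the factor 2, the \<open>i\<close>-th entry of
    \<open>m x - A x\<close>.\<close>
  define z :: "nat \<Rightarrow> real" where "z j = (if j = i then 1 else 0)" for j
  have zz: "(\<Sum>j<n. z j * f j) = f i" for f
    using \<open>i < n\<close> by (simp add: z_def if_distrib[of "\<lambda>x. x * _"] cong: if_cong)
  have "m * x i - (\<Sum>j<n. A i j * x j) = 0"
  proof (rule linear_coefficient_zero)
    fix t :: real
    have "(\<Sum>j<n. (x j + t * z j)\<^sup>2) = (\<Sum>j<n. (x j)\<^sup>2) + 2 * t * (\<Sum>j<n. z j * x j) + t\<^sup>2 * (\<Sum>j<n. z j * z j)"
      by (simp add: power2_eq_square algebra_simps sum.distrib sum_distrib_left)
    also have "\<dots> = (\<Sum>j<n. (x j)\<^sup>2) + 2 * t * x i + t\<^sup>2"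
      by (simp only: zz) (simp add: z_def)
    finally have sq: "(\<Sum>j<n. (x j + t * z j)\<^sup>2) = (\<Sum>j<n. (x j)\<^sup>2) + 2 * t * x i + t\<^sup>2" .
    have "quad_form n A (\<lambda>j. x j + t * z j) \<le> m * (\<Sum>j<n. (x j + t * z j)\<^sup>2)"
      by (rule ub)
    then show "0 \<le> 2 * t * (m * x i - (\<Sum>j<n. A i j * x j)) + t\<^sup>2 * (m - quad_form n A z)"
      unfolding sq quad_form_add[OF sym] zz eq by (simp add: algebra_simps)
  qed
  then show ?thesis
    by simp
qed

section \<open>Eigenvalues of the signed adjacency matrix\<close>

abbreviation (input) kn_index :: "nat \<Rightarrow> nat set set \<Rightarrow> real" where
  "kn_index n U \<equiv> index (signed_Kn_adj n U)"

definition is_eigvec :: "nat \<Rightarrow> nat set set \<Rightarrow> real \<Rightarrow> (nat \<Rightarrow> real) \<Rightarrow> bool" where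
  "is_eigvec n U m x \<longleftrightarrow>
     (\<exists>i<n. x i \<noteq> 0) \<and> (\<forall>i<n. (\<Sum>j<n. signed_entry U i j * x j) = m * x i)"

lemma signed_entry_sym: "signed_entry U i j = signed_entry U j i"
  by (auto simp: signed_entry_def insert_commute)

lemma eigenvalue_signed_Kn_adj_iff: "eigenvalue (signed_Kn_adj n U) m \<longleftrightarrow> (\<exists>x. is_eigvec n U m x)"
proof
  assume "eigenvalue (signed_Kn_adj n U) m"
  then obtain v where v: "v \<in> carrier_vec n" "v \<noteq> 0\<^sub>v n"
    "signed_Kn_adj n U *\<^sub>v v = m \<cdot>\<^sub>v v"
    by (auto simp: eigenvalue_def eigenvector_def signed_Kn_adj_def)
  have "is_eigvec n U m (\<lambda>i. v $ i)"
    unfolding is_eigvec_def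
  proof (intro conjI allI impI)
    show "\<exists>i<n. v $ i \<noteq> 0"
      using v by (metis carrier_vecD eq_vecI index_zero_vec)
    fix i assume "i < n"
    then have "(signed_Kn_adj n U *\<^sub>v v) $ i = (\<Sum>j<n. signed_entry U i j * v $ j)"
      using v(1) by (simp add: signed_Kn_adj_def scalar_prod_def signed_entry_def lessThan_atLeast0)
    then show "(\<Sum>j<n. signed_entry U i j * v $ j) = m * v $ i"
      using v \<open>i < n\<close> by simp
  qed
  then show "\<exists>x. is_eigvec n U m x"
    by blast
next
  assume "\<exists>x. is_eigvec n U m x"
  then obtain x where x: "is_eigvec n U m x" ..
  have "eigenvector (signed_Kn_adj n U) (vec n x) m"
    unfolding eigenvector_def
  proof (intro conjI)
    show "vec n x \<in> carrier_vec (dim_row (signed_Kn_adj n U))"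
      by (simp add: signed_Kn_adj_def)
    show "vec n x \<noteq> 0\<^sub>v (dim_row (signed_Kn_adj n U))"
      using x by (auto simp: signed_Kn_adj_def is_eigvec_def) (metis index_vec index_zero_vec(1))
    show "signed_Kn_adj n U *\<^sub>v vec n x = m \<cdot>\<^sub>v vec n x"
    proof (rule eq_vecI)
      fix i assume "i < dim_vec (m \<cdot>\<^sub>v vec n x)"
      then have i: "i < n" by simp
      then have "(signed_Kn_adj n U *\<^sub>v vec n x) $ i = (\<Sum>j<n. signed_entry U i j * x j)"
        by (simp add: signed_Kn_adj_def scalar_prod_def signed_entry_def lessThan_atLeast0)
      then show "(signed_Kn_adj n U *\<^sub>v vec n x) $ i = (m \<cdot>\<^sub>v vec n x) $ i"
        using x i by (simp add: is_eigvec_def)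
    qed (simp add: signed_Kn_adj_def)
  qed
  then show "eigenvalue (signed_Kn_adj n U) m"
    unfolding eigenvalue_def by blast
qed

text \<open>Eigenvalues are roots of the nonzero characteristic polynomial. Finiteness gives the
  \<open>Max\<close> in \<open>index\<close> its meaning.\<close>

lemma finite_eigenvalues_signed_Kn_adj: "finite {m. eigenvalue (signed_Kn_adj n U) m}"
proof -
  have c: "signed_Kn_adj n U \<in> carrier_mat n n"
    by (simp add: signed_Kn_adj_def)
  then have "char_poly (signed_Kn_adj n U) \<noteq> 0"
    using degree_monic_char_poly[OF c] by auto
  then show ?thesis
    by (simp add: eigenvalue_root_char_poly[OF c] poly_roots_finite)
qed

lemma sum_squares_pos:
  fixes x :: "nat \<Rightarrow> real"
  assumes "i < n" "x i \<noteq> 0"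
  shows "(\<Sum>i<n. (x i)\<^sup>2) > 0"
  using assms by (intro sum_pos2[of _ i]) auto

text \<open>The maximum of the form on the unit sphere is an eigenvalue because a maximizer is
  stationary, and it bounds every eigenvalue because an eigenvalue is the Rayleigh quotient of its
  eigenvector.\<close>

lemma kn_index_rayleigh:
  assumes "n > 0"
  shows kn_index_attained: "\<exists>x. is_eigvec n U (kn_index n U) x"
    and quad_form_le_kn_index: "\<And>y. quad_form n (signed_entry U) y \<le> kn_index n U * (\<Sum>i<n. (y i)\<^sup>2)"
proof -
  let ?Q = "quad_form n (signed_entry U)"
  obtain x where x1: "(\<Sum>i<n. (x i)\<^sup>2) = 1"
    and xm: "\<And>y. (\<Sum>i<n. (y i)\<^sup>2) = 1 \<Longrightarrow> ?Q y \<le> ?Q x"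
    using quad_form_attains_max_on_sphere[OF assms] by blast
  have ub: "?Q y \<le> ?Q x * (\<Sum>i<n. (y i)\<^sup>2)" for y
  proof (cases "\<exists>i<n. y i \<noteq> 0")
    case True
    define r where "r = (\<Sum>i<n. (y i)\<^sup>2)"
    have r: "r > 0"
      unfolding r_def using True sum_squares_pos by blast
    have "(\<Sum>i<n. (1 / sqrt r * y i)\<^sup>2) = 1"
      using r unfolding power_mult_distrib sum_distrib_left[symmetric] r_def[symmetric]
      by (simp add: power_divide)
    then have "?Q (\<lambda>i. 1 / sqrt r * y i) \<le> ?Q x"
      by (rule xm)
    then show ?thesis
      unfolding quad_form_scale r_def[symmetric] using r by (simp add: power_divide field_simps)
  qed (simp add: quad_form_def)
  have "\<exists>i<n. x i \<noteq> 0"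
    using x1 by (metis (no_types, lifting) lessThan_iff power_zero_numeral sum.neutral zero_neq_one)
  then have ev: "is_eigvec n U (?Q x) x"
    unfolding is_eigvec_def
    using rayleigh_maximizer_eigenvector[OF signed_entry_sym ub, of x] x1 by simp
  have "kn_index n U = ?Q x"
    unfolding index_def
  proof (rule Max_eqI)
    fix m assume "m \<in> {m. eigenvalue (signed_Kn_adj n U) m}"
    then obtain y where y: "is_eigvec n U m y"
      by (auto simp: eigenvalue_signed_Kn_adj_iff)
    then have "m * (\<Sum>i<n. (y i)\<^sup>2) \<le> ?Q x * (\<Sum>i<n. (y i)\<^sup>2)"
      using ub[of y] quad_form_eigenvector[of n "signed_entry U" y m] by (simp add: is_eigvec_def)
    then show "m \<le> ?Q x"
      using y sum_squares_pos[of _ n y] by (auto simp: is_eigvec_def)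
  next
    show "?Q x \<in> {m. eigenvalue (signed_Kn_adj n U) m}"
      using ev by (auto simp: eigenvalue_signed_Kn_adj_iff)
  qed (rule finite_eigenvalues_signed_Kn_adj)
  then show "\<exists>x. is_eigvec n U (kn_index n U) x"
    and "\<And>y. ?Q y \<le> kn_index n U * (\<Sum>i<n. (y i)\<^sup>2)"
    using ev ub by auto
qed

text \<open>Equality case of Rayleigh's principle; it turns an optimal test vector into an
  eigenvector.\<close>

lemma quad_form_eq_kn_index_imp_eigvec:
  assumes "quad_form n (signed_entry U) x = kn_index n U * (\<Sum>i<n. (x i)\<^sup>2)"
    and "\<exists>i<n. x i \<noteq> 0"
  shows "is_eigvec n U (kn_index n U) x"
proof -
  have "n > 0"
    using assms(2) by auto
  then show ?thesis
    unfolding is_eigvec_def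
    using rayleigh_maximizer_eigenvector[OF signed_entry_sym quad_form_le_kn_index assms(1)] assms(2)
    by blast
qed

section \<open>Unicyclic graphs\<close>

lemma simple_graphD:
  assumes "simple_graph V E"
  shows "finite V" "finite E" "{v} \<notin> E" "{u, v} \<in> E \<Longrightarrow> u \<in> V \<and> v \<in> V \<and> u \<noteq> v"
    and "e \<in> E \<Longrightarrow> \<exists>a b. a \<in> V \<and> b \<in> V \<and> a \<noteq> b \<and> e = {a, b}"
proof -
  show V: "finite V" and e: "e \<in> E \<Longrightarrow> \<exists>a b. a \<in> V \<and> b \<in> V \<and> a \<noteq> b \<and> e = {a, b}" for e
    using assms by (auto simp: simple_graph_def)
  have "E \<subseteq> Pow V"
    using e by blast
  then show "finite E"
    using V finite_subset by blast
  show "{u, v} \<in> E \<Longrightarrow> u \<in> V \<and> v \<in> V \<and> u \<noteq> v"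
    using e[of "{u, v}"] by (auto simp: doubleton_eq_iff)
  show "{v} \<notin> E"
    using e[of "{v}"] by (auto simp: singleton_insert_inj_eq)
qed

lemma is_cycle_triangle:
  assumes "a \<noteq> b" "b \<noteq> c" "a \<noteq> c"
  shows "is_cycle {{a, b}, {b, c}, {a, c}}" (is "is_cycle ?C")
  unfolding is_cycle_def
proof (intro conjI)
  have "{e\<in>?C. a \<in> e} = {{a, b}, {a, c}}" "{e\<in>?C. b \<in> e} = {{a, b}, {b, c}}"
    "{e\<in>?C. c \<in> e} = {{b, c}, {a, c}}"
    using assms by auto
  then show "\<forall>v\<in>\<Union>?C. card {e\<in>?C. v \<in> e} = 2"
    using assms by (auto simp: card_insert_if doubleton_eq_iff)
  let ?R = "\<lambda>u v. {u, v} \<in> ?C"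
  have "u = v \<or> ?R u v" if "u \<in> \<Union>?C" "v \<in> \<Union>?C" for u v
    using that by (auto simp: insert_commute)
  then show "connected_graph (\<Union>?C) ?C"
    unfolding connected_graph_def by (metis (no_types, lifting) r_into_rtranclp rtranclp.rtrancl_refl)
qed auto

lemma is_cycle_square:
  assumes "distinct [a, b, c, d]"
  shows "is_cycle {{a, b}, {b, c}, {c, d}, {d, a}}" (is "is_cycle ?C")
  unfolding is_cycle_def
proof (intro conjI)
  have "{e\<in>?C. a \<in> e} = {{a, b}, {d, a}}" "{e\<in>?C. b \<in> e} = {{a, b}, {b, c}}"
    "{e\<in>?C. c \<in> e} = {{b, c}, {c, d}}" "{e\<in>?C. d \<in> e} = {{c, d}, {d, a}}"
    using assms by auto
  then show "\<forall>v\<in>\<Union>?C. card {e\<in>?C. v \<in> e} = 2"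
    using assms by (auto simp: card_insert_if doubleton_eq_iff)
  let ?R = "\<lambda>u v. {u, v} \<in> ?C"
  have R: "?R a b" "?R b c" "?R c d" "?R d a" "?R b a" "?R c b" "?R d c" "?R a d"
    by (auto simp: insert_commute)
  have "?R\<^sup>*\<^sup>* u a" "?R\<^sup>*\<^sup>* a u" if "u \<in> \<Union>?C" for u
  proof -
    have "u = a \<or> u = b \<or> u = c \<or> u = d"
      using that by blast
    then show "?R\<^sup>*\<^sup>* u a" "?R\<^sup>*\<^sup>* a u"
      using R by (metis (no_types, lifting) converse_rtranclp_into_rtranclp rtranclp.rtrancl_refl)+
  qed
  then show "connected_graph (\<Union>?C) ?C"
    unfolding connected_graph_def by (meson rtranclp_trans)
qed auto

text \<open>If every edge of \<open>C\<close> contained \<open>a\<close>, the other end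
  \<open>v\<close> of an edge would lie on that edge only, against degree 2.\<close>

lemma cycle_edge_avoiding_vertex:
  assumes E: "simple_graph V E" and C: "C \<subseteq> E" "is_cycle C"
  obtains b c where "{b, c} \<in> C" "b \<noteq> a" "c \<noteq> a" "b \<noteq> c" "b \<in> V" "c \<in> V"
proof -
  have "\<exists>e\<in>C. a \<notin> e"
  proof (rule ccontr)
    assume "\<not> (\<exists>e\<in>C. a \<notin> e)"
    then have all: "\<And>e. e \<in> C \<Longrightarrow> a \<in> e" by blast
    obtain e where e: "e \<in> C"
      using C by (auto simp: is_cycle_def)
    then obtain p q where "e = {p, q}" "p \<noteq> q"
      using simple_graphD(5)[OF E, of e] C by blast
    moreover have "a \<in> e"
      using all e .
    ultimately obtain v where v: "e = {a, v}" "v \<noteq> a"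
      by (cases "p = a") (auto simp: insert_commute)
    have "{f\<in>C. v \<in> f} \<subseteq> {e}"
    proof
      fix f assume f: "f \<in> {f\<in>C. v \<in> f}"
      then obtain p q where "f = {p, q}"
        using simple_graphD(5)[OF E, of f] C by blast
      moreover have "a \<in> f" "v \<in> f"
        using f all by auto
      ultimately show "f \<in> {e}"
        using v by auto
    qed
    then have "card {f\<in>C. v \<in> f} \<le> 1"
      using card_mono[of "{e}"] by fastforce
    moreover have "card {f\<in>C. v \<in> f} = 2"
      using C(2) e v unfolding is_cycle_def by blast
    ultimately show False by simp
  qed
  then obtain e where "e \<in> C" "a \<notin> e" by blast
  with simple_graphD(5)[OF E, of e] C show thesis
    by (metis insertI1 insertI2 subsetD that)
qed

section \<open>Small complete bipartite subgraphs\<close>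

lemma unicyclic_cycle_unique:
  assumes "unicyclic V U" "is_cycle C" "is_cycle D" "C \<subseteq> U" "D \<subseteq> U"
  shows "C = D"
  using assms unfolding unicyclic_def by blast

text \<open>Two vertices of \<open>A\<close> and three of \<open>B\<close> already carry two
  distinct 4-cycles.\<close>

lemma unicyclic_no_K23:
  assumes U: "unicyclic V U" and "A \<inter> B = {}" "card A \<ge> 2" "card B \<ge> 3"
    and K: "\<And>u v. u \<in> A \<Longrightarrow> v \<in> B \<Longrightarrow> {u, v} \<in> U"
  shows False
proof -
  obtain a1 a2 where a: "a1 \<in> A" "a2 \<in> A" "a1 \<noteq> a2"
    using \<open>card A \<ge> 2\<close> by (metis card_2_iff' obtain_subset_with_card_n subset_iff)
  obtain T where T: "T \<subseteq> B" "card T = 3"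
    using \<open>card B \<ge> 3\<close> by (meson obtain_subset_with_card_n)
  then obtain b1 b2 b3 where b: "b1 \<in> B" "b2 \<in> B" "b3 \<in> B" "distinct [b1, b2, b3]"
    by (auto simp: card_3_iff)
  have ab: "a1 \<noteq> b1" "a1 \<noteq> b2" "a1 \<noteq> b3" "a2 \<noteq> b1" "a2 \<noteq> b2" "a2 \<noteq> b3"
    using a b \<open>A \<inter> B = {}\<close> by auto
  have "{{a1, b1}, {b1, a2}, {a2, b2}, {b2, a1}} = {{a1, b1}, {b1, a2}, {a2, b3}, {b3, a1}}"
  proof (rule unicyclic_cycle_unique[OF U])
    show "is_cycle {{a1, b1}, {b1, a2}, {a2, b2}, {b2, a1}}"
      "is_cycle {{a1, b1}, {b1, a2}, {a2, b3}, {b3, a1}}"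
      using ab a b by (auto intro!: is_cycle_square)
    show "{{a1, b1}, {b1, a2}, {a2, b2}, {b2, a1}} \<subseteq> U" "{{a1, b1}, {b1, a2}, {a2, b3}, {b3, a1}} \<subseteq> U"
      using K a b by (auto simp: insert_commute)
  qed
  moreover have "{a2, b2} \<in> {{a1, b1}, {b1, a2}, {a2, b2}, {b2, a1}}"
    by simp
  ultimately have "{a2, b2} \<in> {{a1, b1}, {b1, a2}, {a2, b3}, {b3, a1}}"
    by (simp only:)
  then show False
    using ab a b by (auto simp: doubleton_eq_iff)
qed

text \<open>One pair \<open>{b, c}\<close> may be missing. Dropping one of its ends from a side that
  can afford it leaves a complete bipartite graph on 2 + 3 vertices.\<close>

lemma unicyclic_no_K23_minus:
  assumes U: "unicyclic V U" and fin: "finite A" "finite B" and disj: "A \<inter> B = {}"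
    and cd: "card A \<ge> 2" "card B \<ge> 2" "card A + card B \<ge> 6"
    and K: "\<And>u v. u \<in> A \<Longrightarrow> v \<in> B \<Longrightarrow> {u, v} \<noteq> {b, c} \<Longrightarrow> {u, v} \<in> U"
  shows False
proof -
  \<comment> \<open>The missing pair, if it crosses at all, is oriented so that \<open>s\<close> is
    its end in \<open>A\<close> and \<open>t\<close> its end in \<open>B\<close>.\<close>
  obtain s t where st: "\<And>u v. u \<in> A \<Longrightarrow> v \<in> B \<Longrightarrow> u \<noteq> s \<or> v \<noteq> t \<Longrightarrow> {u, v} \<in> U"
  proof (cases "b \<in> A \<and> c \<in> B")
    case True
    then show thesis
      using that[of b c] K disj by (metis disjoint_iff doubleton_eq_iff)
  next
    case False
    then show thesis
      using that[of c b] K disj by (metis disjoint_iff doubleton_eq_iff)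
  qed
  have ts: "\<And>u v. u \<in> B \<Longrightarrow> v \<in> A \<Longrightarrow> u \<noteq> t \<or> v \<noteq> s \<Longrightarrow> {u, v} \<in> U"
    using st by (metis insert_commute)
  have A: "card (A - {s}) \<ge> card A - 1" and B: "card (B - {t}) \<ge> card B - 1"
    using fin by (auto simp: card_Diff_singleton_if)
  consider "card B \<ge> 4" | "card B = 3" | "card B = 2"
    using cd by linarith
  then show False
  proof cases
    case 1
    with B cd disj st show False
      by (intro unicyclic_no_K23[OF U, of A "B - {t}"]) auto
  next
    case 2
    with B cd disj ts show False
      by (intro unicyclic_no_K23[OF U, of "B - {t}" A]) auto
  next
    case 3
    with A cd disj ts show False
      by (intro unicyclic_no_K23[OF U, of B "A - {s}"]) auto
  qed
qed

section \<open>The extremal graph\<close>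

text \<open>For distinct \<open>a\<close>, \<open>b\<close>, \<open>c\<close> in \<open>V\<close>
  this is a copy of the extremal graph: the triangle \<open>abc\<close> with all other vertices of
  \<open>V\<close> pendant at \<open>a\<close>.\<close>

definition star_plus_edge :: "nat set \<Rightarrow> nat \<Rightarrow> nat \<Rightarrow> nat \<Rightarrow> nat set set" where
  "star_plus_edge V a b c = insert {b, c} ((\<lambda>v. {a, v}) ` (V - {a}))"

lemma doubleton_in_star_plus_edge:
  assumes "b \<noteq> a" "c \<noteq> a" "b \<noteq> c"
  shows "{u, v} \<in> star_plus_edge V a b c \<longleftrightarrow>
    u = a \<and> v \<in> V \<and> v \<noteq> a \<or> v = a \<and> u \<in> V \<and> u \<noteq> a \<or> u = b \<and> v = c \<or> u = c \<and> v = b"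
  using assms by (auto simp: star_plus_edge_def doubleton_eq_iff image_iff)

text \<open>A cycle has an edge avoiding \<open>a\<close>, which can only be \<open>{b, c}\<close>.
  Degree 2 at \<open>b\<close> and \<open>c\<close> then forces the edges to \<open>a\<close>, while
  every other leaf of the star has degree 1.\<close>

lemma unicyclic_star_plus_edge:
  assumes V: "finite V" "a \<in> V" "b \<in> V" "c \<in> V" and d: "b \<noteq> a" "c \<noteq> a" "b \<noteq> c"
  shows "unicyclic V (star_plus_edge V a b c)" (is "unicyclic V ?H")
  unfolding unicyclic_def
proof (intro conjI)
  show H: "simple_graph V ?H"
    using assms by (auto simp: star_plus_edge_def simple_graph_def)
  let ?R = "\<lambda>u v. {u, v} \<in> ?H"
  have "?R\<^sup>*\<^sup>* u a" "?R\<^sup>*\<^sup>* a u" if "u \<in> V" for u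
    using that by (cases "u = a"; force simp: doubleton_in_star_plus_edge[OF d] intro!: r_into_rtranclp)+
  then show "connected_graph V ?H"
    unfolding connected_graph_def by (meson rtranclp_trans)
  show "\<exists>!C. C \<subseteq> ?H \<and> is_cycle C"
  proof (rule ex1I)
    show "{{a, b}, {b, c}, {a, c}} \<subseteq> ?H \<and> is_cycle {{a, b}, {b, c}, {a, c}}"
      using assms by (auto intro!: is_cycle_triangle simp: doubleton_in_star_plus_edge)
    fix C assume "C \<subseteq> ?H \<and> is_cycle C"
    then have C: "C \<subseteq> ?H" "is_cycle C" by auto
    obtain u v where uv: "{u, v} \<in> C" "u \<noteq> a" "v \<noteq> a" "u \<noteq> v"
      using cycle_edge_avoiding_vertex[OF H C] by blast
    then have bc: "{b, c} \<in> C"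
      using C d by (auto simp: doubleton_in_star_plus_edge dest!: subsetD)
        (auto simp: insert_commute)
    have deg: "card {e\<in>C. v \<in> e} = 2" if "e \<in> C" "v \<in> e" for e v
      using C(2) that unfolding is_cycle_def by blast
    have inc: "{e\<in>C. v \<in> e} \<subseteq> (if v = b \<or> v = c then {{b, c}, {a, v}} else {{a, v}})" if "v \<noteq> a" for v
      using C(1) that by (auto simp: star_plus_edge_def)
    have b: "{a, v} \<in> C" if "v = b \<or> v = c" for v
    proof (rule ccontr)
      assume "{a, v} \<notin> C"
      then have "{e\<in>C. v \<in> e} \<subseteq> {{b, c}}"
        using inc[of v] that d by (auto split: if_splits)
      then have "card {e\<in>C. v \<in> e} \<le> 1"
        using card_mono[of "{{b, c}}"] by fastforce
      then show False
        using deg[OF bc, of v] that by auto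
    qed
    have "v = b \<or> v = c" if "{a, v} \<in> C" "v \<noteq> a" for v
    proof (rule ccontr)
      assume "\<not> (v = b \<or> v = c)"
      then have "card {e\<in>C. v \<in> e} \<le> card {{a, v}}"
        using inc[of v] that by (intro card_mono) auto
      then show False
        using deg[OF that(1), of v] by auto
    qed
    then have "C \<subseteq> {{a, b}, {b, c}, {a, c}}"
      using C(1) by (auto simp: star_plus_edge_def)
    then show "C = {{a, b}, {b, c}, {a, c}}"
      using b bc by auto
  qed
qed

text \<open>Every edge avoiding \<open>a\<close> closes a triangle with \<open>a\<close>, so
  uniqueness of the cycle leaves exactly one such edge \<open>{b, c}\<close>.\<close>

lemma unicyclic_dominating_vertex_iso:
  assumes U: "unicyclic V U" and k: "card V = k" and a: "a \<in> V"
    and dom: "\<And>v. v \<in> V \<Longrightarrow> v \<noteq> a \<Longrightarrow> {a, v} \<in> U"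
  shows "graph_iso V U {..<k} (triangle_pendants k)"
proof -
  have E: "simple_graph V U"
    using U by (simp add: unicyclic_def)
  obtain C where C: "C \<subseteq> U" "is_cycle C"
    using U by (auto simp: unicyclic_def)
  obtain b c where bc: "{b, c} \<in> U" "b \<noteq> a" "c \<noteq> a" "b \<noteq> c" "b \<in> V" "c \<in> V"
    using cycle_edge_avoiding_vertex[OF E C, of a] C by blast
  have other: "{u, v} = {b, c}" if uv: "{u, v} \<in> U" "u \<noteq> a" "v \<noteq> a" for u v
  proof -
    have "u \<noteq> v" "u \<in> V" "v \<in> V"
      using simple_graphD(4)[OF E uv(1)] by auto
    then have "{{a, u}, {u, v}, {a, v}} = {{a, b}, {b, c}, {a, c}}"
      using uv bc dom by (intro unicyclic_cycle_unique[OF U] is_cycle_triangle) auto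
    moreover have "{u, v} \<in> {{a, u}, {u, v}, {a, v}}"
      by simp
    ultimately have "{u, v} \<in> {{a, b}, {b, c}, {a, c}}"
      by (simp only:)
    then show ?thesis
      using uv(2,3) by (simp add: doubleton_eq_iff)
  qed
  have iff: "{u, v} \<in> U \<longleftrightarrow> u \<noteq> v \<and> (u = a \<or> v = a \<or> {u, v} = {b, c})" if "u \<in> V" "v \<in> V" for u v
    using other[of u v] simple_graphD(4)[OF E, of u v] dom[of u] dom[of v] that bc
    by (auto simp: insert_commute)
  have fin: "finite V"
    using simple_graphD(1)[OF E] .
  have c3: "card (V - {a, b, c}) = k - 3" "k \<ge> 3"
    using k bc a fin card_mono[of V "{a, b, c}"] by (auto simp: card_Diff_subset)
  then obtain g where g: "bij_betw g (V - {a, b, c}) {3..<k}"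
    using finite_same_card_bij[of "V - {a, b, c}" "{3..<k}"] fin by auto
  \<comment> \<open>The centre \<open>a\<close> goes to 0 and \<open>b\<close>, \<open>c\<close> to
    1, 2; \<open>g\<close> numbers the pendant vertices from 3 on.\<close>
  define f where "f v = (if v = a then 0 else if v = b then 1 else if v = c then 2 else g v)" for v
  have g3: "g v \<ge> 3" "g v < k" if "v \<in> V" "v \<noteq> a" "v \<noteq> b" "v \<noteq> c" for v
    using g that by (auto simp: bij_betw_def)
  have "bij_betw f ({a, b, c} \<union> (V - {a, b, c})) ({0, 1, 2} \<union> {3..<k})"
  proof (rule bij_betw_combine)
    show "bij_betw f {a, b, c} {0, 1, 2}"
      using bc by (auto simp: bij_betw_def f_def)
    show "bij_betw f (V - {a, b, c}) {3..<k}"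
      using g by (rule bij_betw_cong[THEN iffD1, rotated]) (auto simp: f_def)
  qed auto
  moreover have "{a, b, c} \<union> (V - {a, b, c}) = V" "{0, 1, 2} \<union> {3..<k} = {..<k}"
    using a bc c3 by auto
  ultimately have bij: "bij_betw f V {..<k}"
    by simp
  have inj: "f u = f v \<longleftrightarrow> u = v" if "u \<in> V" "v \<in> V" for u v
    using bij that by (auto simp: bij_betw_def inj_on_def)
  have f0: "f v = 0 \<longleftrightarrow> v = a" "f v = Suc 0 \<longleftrightarrow> v = b" "f v = 2 \<longleftrightarrow> v = c" if "v \<in> V" for v
    using g3[of v] that bc by (auto simp: f_def)
  have lt: "f v < k" if "v \<in> V" for v
    using bij that by (auto simp: bij_betw_def)
  have tp: "{p, q} \<in> triangle_pendants k \<longleftrightarrow> p \<noteq> q \<and> (p = 0 \<or> q = 0 \<or> {p, q} = {1, 2})"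
    if "p < k" "q < k" for p q
  proof -
    have r: "r = 1 \<or> r = 2 \<or> r \<ge> 3" if "r \<noteq> 0" for r :: nat
      using that by auto
    show ?thesis
      using that r[of p] r[of q] unfolding triangle_pendants_def
      by (auto simp: doubleton_eq_iff)
  qed
  have "{u, v} \<in> U \<longleftrightarrow> {f u, f v} \<in> triangle_pendants k" if "u \<in> V" "v \<in> V" for u v
    using that by (simp add: iff tp lt inj f0 doubleton_eq_iff)
  then show ?thesis
    unfolding graph_iso_def using bij by blast
qed

text \<open>The cycle has an edge avoiding each given vertex, and on three vertices that edge joins
  the other two; hence \<open>p\<close> is adjacent to both \<open>q\<close> and
  \<open>r\<close>.\<close>

lemma unicyclic_three_vertices_iso:
  assumes U: "unicyclic V U" and k: "card V = 3"
  shows "graph_iso V U {..<3} (triangle_pendants 3)"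
proof -
  have E: "simple_graph V U"
    using U by (simp add: unicyclic_def)
  obtain C where C: "C \<subseteq> U" "is_cycle C"
    using U by (auto simp: unicyclic_def)
  obtain p q r where V: "V = {p, q, r}" "p \<noteq> q" "q \<noteq> r" "p \<noteq> r"
    using k by (auto simp: card_3_iff)
  have "{p, q} \<in> U"
    using cycle_edge_avoiding_vertex[OF E C, of r] C V by (metis insert_commute insertE singletonD subsetD)
  moreover have "{p, r} \<in> U"
    using cycle_edge_avoiding_vertex[OF E C, of q] C V by (metis insert_commute insertE singletonD subsetD)
  ultimately show ?thesis
    using V k by (intro unicyclic_dominating_vertex_iso[OF U, of _ p]) auto
qed

section \<open>Quadratic forms of signed complete graphs\<close>

text \<open>The signed adjacency matrix is \<open>J - I - 2 A\<close>, with \<open>J\<close> the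
  all-ones matrix and \<open>A\<close> the adjacency matrix of \<open>U\<close>. The assumption on
  \<open>{i}\<close> keeps \<open>j = i\<close> out of the last sum, as
  \<open>{i, i} = {i}\<close>.\<close>

lemma signed_row_sum:
  assumes "i < n" "{i} \<notin> U"
  shows "(\<Sum>j<n. signed_entry U i j * x j) = (\<Sum>j<n. x j) - x i - 2 * (\<Sum>j | j < n \<and> {i, j} \<in> U. x j)"
proof -
  have "(\<Sum>j<n. signed_entry U i j * x j) =
      (\<Sum>j<n. x j - (if j = i then x i else 0) - 2 * (if {i, j} \<in> U then x j else 0))"
    using assms by (intro sum.cong) (auto simp: signed_entry_def)
  also have "\<dots> = (\<Sum>j<n. x j) - x i - 2 * (\<Sum>j<n. if {i, j} \<in> U then x j else 0)"
    using assms by (simp add: sum_subtractf flip: sum_distrib_left)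
  also have "(\<Sum>j<n. if {i, j} \<in> U then x j else 0) = (\<Sum>j | j < n \<and> {i, j} \<in> U. x j)"
    by (simp add: sum.If_cases Int_def conj_commute)
  finally show ?thesis .
qed

text \<open>The form in which eigenvector equations are compared: the right-hand side depends on
  \<open>i\<close> only through its neighbours in \<open>U\<close>.\<close>

lemma eigvec_row:
  assumes "is_eigvec n U m x" "i < n" "{i} \<notin> U"
  shows "(m + 1) * x i = (\<Sum>j<n. x j) - 2 * (\<Sum>j | j < n \<and> {i, j} \<in> U. x j)"
  using assms signed_row_sum[OF assms(2,3), of x] by (auto simp: is_eigvec_def algebra_simps)

text \<open>Every edge occurs in both orientations. Writing its weight as \<open>prod x e\<close>
  avoids choosing one.\<close>

lemma sum_over_ordered_pairs:
  fixes x :: "nat \<Rightarrow> real"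
  assumes "finite E" "simple_graph V E" "V \<subseteq> {..<n}"
  shows "(\<Sum>i<n. \<Sum>j<n. if {i, j} \<in> E then x i * x j else 0) = 2 * (\<Sum>e\<in>E. prod x e)"
  using assms
proof (induction E rule: finite_induct)
  case (insert e E)
  then obtain u v where e: "e = {u, v}" "u \<noteq> v" "u \<in> V" "v \<in> V"
    by (auto simp: simple_graph_def)
  then have uv: "u < n" "v < n"
    using insert.prems by auto
  have E: "simple_graph V E"
    using insert.prems by (auto simp: simple_graph_def)
  have "(\<Sum>i<n. \<Sum>j<n. if {i, j} \<in> insert e E then x i * x j else 0)
      = (\<Sum>i<n. \<Sum>j<n. (if {i, j} \<in> E then x i * x j else 0)
          + (if i = u then if j = v then x u * x v else 0 else 0)
          + (if i = v then if j = u then x u * x v else 0 else 0))"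
    using insert.hyps e by (intro sum.cong) (auto simp: doubleton_eq_iff insert_commute)
  also have "\<dots> = 2 * (\<Sum>e\<in>E. prod x e) + 2 * (x u * x v)"
  proof -
    have "(\<Sum>i<n. \<Sum>j<n. if i = p then if j = q then x u * x v else 0 else 0) = x u * x v"
      if "p < n" "q < n" for p q
    proof -
      have "(\<Sum>i<n. \<Sum>j<n. if i = p then if j = q then x u * x v else 0 else 0)
          = (\<Sum>i<n. if i = p then (\<Sum>j<n. if j = q then x u * x v else 0) else 0)"
        by (intro sum.cong) auto
      then show ?thesis
        using that by simp
    qed
    then show ?thesis
      using uv insert.IH[OF E] insert.prems by (simp add: sum.distrib)
  qed
  finally show ?case
    using insert.hyps e by simp
qed simp

text \<open>Again \<open>J - I - 2 A\<close>. For a fixed vector, increasing the form thus means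
  decreasing the total weight of the negative edges.\<close>

lemma quad_form_signed_entry:
  assumes "simple_graph V U" "V \<subseteq> {..<n}"
  shows "quad_form n (signed_entry U) x = (\<Sum>i<n. x i)\<^sup>2 - (\<Sum>i<n. (x i)\<^sup>2) - 4 * (\<Sum>e\<in>U. prod x e)"
proof -
  have "quad_form n (signed_entry U) x = (\<Sum>i<n. \<Sum>j<n. x i * x j - (if j = i then (x i)\<^sup>2 else 0)
      - 2 * (if {i, j} \<in> U then x i * x j else 0))"
    unfolding quad_form_def using simple_graphD(3)[OF assms(1)]
    by (intro sum.cong) (auto simp: signed_entry_def power2_eq_square)
  also have "\<dots> = (\<Sum>i<n. x i)\<^sup>2 - (\<Sum>i<n. (x i)\<^sup>2)
      - 2 * (\<Sum>i<n. \<Sum>j<n. if {i, j} \<in> U then x i * x j else 0)"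
    by (simp add: sum_subtractf power2_eq_square sum_product flip: sum_distrib_left)
  finally show ?thesis
    using sum_over_ordered_pairs[OF simple_graphD(2)[OF assms(1)] assms] by simp
qed

lemma sum_prod_star:
  fixes x :: "nat \<Rightarrow> real"
  assumes "a \<notin> A"
  shows "(\<Sum>e\<in>(\<lambda>v. {a, v}) ` A. prod x e) = x a * (\<Sum>v\<in>A. x v)"
proof -
  have "inj_on (\<lambda>v. {a, v}) A"
    by (auto simp: inj_on_def doubleton_eq_iff)
  then have "(\<Sum>e\<in>(\<lambda>v. {a, v}) ` A. prod x e) = (\<Sum>v\<in>A. prod x {a, v})"
    by (simp add: sum.reindex)
  also have "\<dots> = (\<Sum>v\<in>A. x a * x v)"
  proof (intro sum.cong refl)
    fix v assume "v \<in> A"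
    then have "a \<noteq> v"
      using assms by auto
    then show "prod x {a, v} = x a * x v"
      by simp
  qed
  finally show ?thesis
    by (simp add: sum_distrib_left)
qed

lemma sum_prod_star_plus_edge:
  fixes x :: "nat \<Rightarrow> real"
  assumes "finite V" "b \<noteq> a" "c \<noteq> a" "b \<noteq> c"
  shows "(\<Sum>e\<in>star_plus_edge V a b c. prod x e) = x a * (\<Sum>v\<in>V - {a}. x v) + x b * x c"
proof -
  have "{b, c} \<notin> (\<lambda>v. {a, v}) ` (V - {a})"
  proof
    assume "{b, c} \<in> (\<lambda>v. {a, v}) ` (V - {a})"
    then obtain v where "{b, c} = {a, v}"
      by (rule imageE)
    then have "a \<in> {b, c}"
      by (simp only: insertI1)
    then show False
      using assms by simp
  qed
  then show ?thesis
    unfolding star_plus_edge_def using assms sum_prod_star[of a "V - {a}" x] by simp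
qed

section \<open>Weights of spanning forests\<close>

lemma rtranclp_crosses_boundary:
  assumes "R\<^sup>*\<^sup>* a v" "a \<in> B" "v \<notin> B"
  obtains p q where "R p q" "p \<in> B" "q \<notin> B"
  using assms by (induction rule: rtranclp_induct) blast+

text \<open>The forest starts as the full star at \<open>a\<close> inside \<open>E\<close>, so every edge of \<open>E\<close> left over
  avoids \<open>a\<close> and has nonnegative weight. Each further edge attaches a new vertex, whose weight it
  picks up with a factor at least \<open>x a\<close>.\<close>

lemma spanning_forest_weight:
  fixes x :: "nat \<Rightarrow> real"
  assumes E: "simple_graph V E" and conn: "connected_graph V E" and a: "a \<in> V"
    and nn: "\<And>v. v \<in> V \<Longrightarrow> v \<noteq> a \<Longrightarrow> 0 \<le> x v" and min: "\<And>v. v \<in> V \<Longrightarrow> x a \<le> x v"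
  obtains F where "F \<subseteq> E" "\<And>e. e \<in> E \<Longrightarrow> a \<in> e \<Longrightarrow> e \<in> F" "\<And>C. C \<subseteq> F \<Longrightarrow> \<not> is_cycle C"
    and "x a * (\<Sum>v\<in>V - {a}. x v) \<le> (\<Sum>e\<in>F. prod x e)"
proof -
  \<comment> \<open>\<open>B\<close> is the set of vertices reached so far, and \<open>F\<close> a
    forest on it that already has all edges at \<open>a\<close>.\<close>
  define P where "P B F \<longleftrightarrow> a \<in> B \<and> B \<subseteq> V \<and> F \<subseteq> E \<and> (\<forall>e\<in>E. a \<in> e \<longrightarrow> e \<in> F) \<and> \<Union>F \<subseteq> B
    \<and> (\<forall>C. C \<subseteq> F \<longrightarrow> \<not> is_cycle C) \<and> x a * (\<Sum>v\<in>B - {a}. x v) \<le> (\<Sum>e\<in>F. prod x e)" for B F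
  have fV: "finite V" and fE: "finite E"
    using simple_graphD[OF E] by auto
  have grow: "\<exists>F'. P V F'" if "P B F" for B F
    using that
  proof (induction "card (V - B)" arbitrary: B F rule: less_induct)
    case less
    show ?case
    proof (cases "B = V")
      case True
      then show ?thesis using less.prems by blast
    next
      case False
      have BF: "a \<in> B" "B \<subseteq> V" "F \<subseteq> E" "\<And>e. e \<in> E \<Longrightarrow> a \<in> e \<Longrightarrow> e \<in> F" "\<Union>F \<subseteq> B"
        "\<And>C. C \<subseteq> F \<Longrightarrow> \<not> is_cycle C" "x a * (\<Sum>v\<in>B - {a}. x v) \<le> (\<Sum>e\<in>F. prod x e)"
        using less.prems by (auto simp: P_def)
      obtain v where v: "v \<in> V" "v \<notin> B"
        using False BF by blast
      then have "(\<lambda>p q. {p, q} \<in> E)\<^sup>*\<^sup>* a v"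
        using conn a by (simp add: connected_graph_def)
      then obtain p q where pq: "{p, q} \<in> E" "p \<in> B" "q \<notin> B"
        using rtranclp_crosses_boundary[of "\<lambda>p q. {p, q} \<in> E" a v B] BF v by auto
      have q: "q \<in> V" "p \<in> V" "p \<noteq> q" "q \<noteq> a"
        using simple_graphD(4)[OF E pq(1)] pq BF by auto
      have nF: "{p, q} \<notin> F"
        using BF(5) pq by blast
      have fin: "finite F" "finite B"
        using BF fV fE finite_subset by blast+
      have "P (insert q B) (insert {p, q} F)"
        unfolding P_def
      proof (intro conjI allI impI)
        fix C assume C: "C \<subseteq> insert {p, q} F"
        show "\<not> is_cycle C"
        proof
          assume cyc: "is_cycle C"
          \<comment> \<open>A cycle would have to use the new edge, but the end \<open>q\<close> of
            that edge has degree 1.\<close>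
          have "{p, q} \<in> C"
            using BF(6)[of C] C cyc by blast
          then have "card {e\<in>C. q \<in> e} = 2"
            using cyc unfolding is_cycle_def by blast
          moreover have "{e\<in>C. q \<in> e} \<subseteq> {{p, q}}"
            using C BF(5) pq by blast
          then have "card {e\<in>C. q \<in> e} \<le> card {{p, q}}"
            by (intro card_mono) auto
          ultimately show False by simp
        qed
      next
        have "x a * x q \<le> x p * x q"
          using min[OF q(2)] nn[OF q(1,4)] by (rule mult_right_mono)
        moreover have "insert q B - {a} = insert q (B - {a})"
          using q by auto
        ultimately show "x a * (\<Sum>v\<in>insert q B - {a}. x v) \<le> (\<Sum>e\<in>insert {p, q} F. prod x e)"
          using BF(7) fin nF pq q by (simp add: algebra_simps)
      qed (use BF pq q in auto)
      moreover have "card (V - insert q B) < card (V - B)"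
        using pq q fV by (intro psubset_card_mono) auto
      ultimately show ?thesis
        using less.hyps by blast
    qed
  qed
  define S where "S = {v\<in>V - {a}. {a, v} \<in> E}"
  have star: "{e\<in>E. a \<in> e} = (\<lambda>v. {a, v}) ` S"
  proof (intro equalityI subsetI)
    fix e assume e: "e \<in> {e\<in>E. a \<in> e}"
    then obtain p q where "p \<in> V" "q \<in> V" "p \<noteq> q" "e = {p, q}"
      using simple_graphD(5)[OF E, of e] by blast
    with e show "e \<in> (\<lambda>v. {a, v}) ` S"
      by (cases "p = a") (auto simp: S_def insert_commute)
  qed (auto simp: S_def)
  have "P (insert a S) {e\<in>E. a \<in> e}"
    unfolding P_def
  proof (intro conjI allI impI)
    fix C assume C: "C \<subseteq> {e\<in>E. a \<in> e}"
    then have "C \<subseteq> E" by blast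
    then show "\<not> is_cycle C"
      using cycle_edge_avoiding_vertex[OF E, of C a] C by blast
  next
    show "x a * (\<Sum>v\<in>insert a S - {a}. x v) \<le> (\<Sum>e\<in>{e\<in>E. a \<in> e}. prod x e)"
      unfolding star by (subst sum_prod_star) (auto simp: S_def)
  next
    show "\<Union>{e\<in>E. a \<in> e} \<subseteq> insert a S"
      unfolding star by auto
  qed (use a in \<open>auto simp: S_def\<close>)
  then obtain F where "P V F"
    using grow by blast
  then show thesis
    unfolding P_def by (intro that[of F]) auto
qed

section \<open>Comparison of forms, and eigenvectors of the extremal graph\<close>

lemma eigvec_uminus: "is_eigvec n U m x \<Longrightarrow> is_eigvec n U m (\<lambda>i. - x i)"
  by (simp add: is_eigvec_def sum_negf)

text \<open>Equal totals leave no slack in any term. This allows the signs of \<open>U\<close> to be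
  read off from those of the comparison graph.\<close>

lemma quad_form_mono_eq:
  assumes le: "\<And>i j. i < n \<Longrightarrow> j < n \<Longrightarrow> A i j * x i * x j \<le> B i j * y i * y j"
    and eq: "quad_form n A x = quad_form n B y" and ij: "i < n" "j < n"
  shows "A i j * x i * x j = B i j * y i * y j"
proof -
  have "(\<Sum>j<n. A i j * x i * x j) = (\<Sum>j<n. B i j * y i * y j)"
    by (rule sum_mono_inv[OF eq[unfolded quad_form_def]]) (use le ij in \<open>auto intro: sum_mono\<close>)
  then show ?thesis
    by (rule sum_mono_inv) (use le ij in auto)
qed

text \<open>If \<open>x v = 0\<close>, the eigenvector equations force \<open>?S = 2 * x a\<close>,
  so the entries off \<open>a\<close> sum to \<open>x a\<close>. They are nonnegative and
  \<open>x a\<close> is not positive, hence \<open>x\<close> vanishes.\<close>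

lemma star_plus_edge_eigvec_pos:
  assumes V: "V \<subseteq> {..<n}" "a \<in> V" "b \<in> V" "c \<in> V" and d: "b \<noteq> a" "c \<noteq> a" "b \<noteq> c"
    and ev: "is_eigvec n (star_plus_edge V a b c) m x" and m: "m > 1"
    and xa: "x a \<le> 0" and nn: "\<And>v. v < n \<Longrightarrow> v \<noteq> a \<Longrightarrow> 0 \<le> x v"
    and v: "v \<in> V" "v \<noteq> a"
  shows "x v > 0"
proof (rule ccontr)
  let ?H = "star_plus_edge V a b c" and ?S = "\<Sum>j<n. x j"
  have ltn: "a < n" "b < n" "c < n" "v < n"
    using V v by auto
  assume "\<not> x v > 0"
  then have v0: "x v = 0"
    using nn[of v] v ltn by auto
  have row: "(m + 1) * x i = ?S - 2 * (\<Sum>j | j < n \<and> {i, j} \<in> ?H. x j)" if "i < n" for i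
    using eigvec_row[OF ev that] doubleton_in_star_plus_edge[OF d, of i i V] d by auto
  have edge: "x q = 0 \<and> ?S = 2 * x a"
    if pq: "p = b \<and> q = c \<or> p = c \<and> q = b" and p: "x p = 0" for p q
  proof -
    have pq': "p < n" "q < n" "p \<noteq> a" "q \<noteq> a"
      using pq ltn d by auto
    have mem: "{p, j} \<in> ?H \<longleftrightarrow> j = a \<or> j = q" "{q, j} \<in> ?H \<longleftrightarrow> j = a \<or> j = p" for j
      using pq d V(3,4) unfolding doubleton_in_star_plus_edge[OF d] by blast+
    have "{j. j < n \<and> {p, j} \<in> ?H} = {a, q}" "{j. j < n \<and> {q, j} \<in> ?H} = {a, p}"
      unfolding mem using pq' ltn(1) by auto
    then have *: "0 = ?S - 2 * (x a + x q)" "(m + 1) * x q = ?S - 2 * x a"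
      using row[OF pq'(1)] row[OF pq'(2)] p pq' by simp_all
    \<comment> \<open>If one of \<open>b\<close>, \<open>c\<close> has entry 0, the two equations
      combine to this one, and \<open>m > 1\<close> makes the other entry 0 as well.\<close>
    then have "(m + 1) * x q = 2 * x q"
      by simp
    then have "x q = 0"
      using m by (simp only: mult_cancel_right) simp
    then show ?thesis
      using * by simp
  qed
  have "?S = 2 * x a"
  proof (cases "v = b \<or> v = c")
    case True
    then show ?thesis
      using edge[of b c] edge[of c b] v0 by auto
  next
    case False
    then have "{j. j < n \<and> {v, j} \<in> ?H} = {a}"
      using d v ltn by (auto simp: doubleton_in_star_plus_edge)
    then show ?thesis
      using row[OF ltn(4)] v0 by simp
  qed
  moreover have S: "?S = x a + (\<Sum>j\<in>{..<n} - {a}. x j)"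
    using ltn by (simp add: sum.remove)
  moreover have "(\<Sum>j\<in>{..<n} - {a}. x j) \<ge> 0"
    using nn by (intro sum_nonneg) auto
  ultimately have "x a = 0" "(\<Sum>j\<in>{..<n} - {a}. x j) = 0"
    using xa by linarith+
  then have "\<forall>j\<in>{..<n} - {a}. x j = 0"
    by (subst (asm) sum_nonneg_eq_0_iff) (use nn in auto)
  then have "\<forall>j<n. x j = 0"
    using \<open>x a = 0\<close> by (metis Diff_iff lessThan_iff singletonD)
  then show False
    using ev by (auto simp: is_eigvec_def)
qed

text \<open>For the vector that is 0 at \<open>a\<close> and 1 elsewhere, the star has weight 0 and
  \<open>{b, c}\<close> is the only negative edge that counts. The Rayleigh quotient is
  \<open>n - 2 - 4 / (n - 1)\<close>, which exceeds 3 from \<open>n = 6\<close> on.\<close>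

lemma kn_index_star_plus_edge_gt:
  assumes n: "n > 5" and V: "V \<subseteq> {..<n}" "a \<in> V" "b \<in> V" "c \<in> V"
    and d: "b \<noteq> a" "c \<noteq> a" "b \<noteq> c"
  shows "kn_index n (star_plus_edge V a b c) > 3"
proof -
  let ?H = "star_plus_edge V a b c"
  define x :: "nat \<Rightarrow> real" where "x i = (if i = a then 0 else 1)" for i
  have fV: "finite V"
    using V finite_subset by blast
  have "simple_graph V ?H"
    using unicyclic_star_plus_edge[OF fV V(2-) d] by (simp add: unicyclic_def)
  then have q: "quad_form n (signed_entry ?H) x = (\<Sum>i<n. x i)\<^sup>2 - (\<Sum>i<n. (x i)\<^sup>2) - 4 * (\<Sum>e\<in>?H. prod x e)"
    using V by (intro quad_form_signed_entry)
  have "(\<Sum>i<n. x i) = (\<Sum>i\<in>{..<n} - {a}. 1)"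
    using V by (intro sum.mono_neutral_cong_right) (auto simp: x_def)
  then have s: "(\<Sum>i<n. x i) = real n - 1"
    using V n by (auto simp: of_nat_diff)
  have "(\<Sum>i<n. (x i)\<^sup>2) = (\<Sum>i<n. x i)"
    by (intro sum.cong) (auto simp: x_def)
  then have s2: "(\<Sum>i<n. (x i)\<^sup>2) = real n - 1"
    using s by simp
  have "(\<Sum>e\<in>?H. prod x e) = 1"
    using sum_prod_star_plus_edge[OF fV d, of x] d by (simp add: x_def)
  then have "(real n - 1)\<^sup>2 - (real n - 1) - 4 \<le> kn_index n ?H * (real n - 1)"
    using q s s2 quad_form_le_kn_index[of n ?H x] n by simp
  moreover have "(real n - 1)\<^sup>2 - (real n - 1) - 4 > 3 * (real n - 1)"
  proof -
    have "0 \<le> (real n - 6) * (real n)"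
      using n by (intro mult_nonneg_nonneg) auto
    then show ?thesis
      by (simp add: power2_eq_square algebra_simps)
  qed
  ultimately have "3 * (real n - 1) < kn_index n ?H * (real n - 1)"
    by linarith
  then show ?thesis
    by (rule mult_right_less_imp_less) (use n in simp)
qed

section \<open>Extremal unicyclic graphs\<close>

text \<open>The competitors are copies of the extremal graph on the vertex set of \<open>U\<close>
  itself, so vectors can be compared vertex by vertex.\<close>

locale extremal_unicyclic =
  fixes n :: nat and V :: "nat set" and U :: "nat set set"
  assumes n: "n > 5" and V: "V \<subseteq> {..<n}" and U: "unicyclic V U"
    and extremal: "\<And>a b c. a \<in> V \<Longrightarrow> b \<in> V \<Longrightarrow> c \<in> V \<Longrightarrow> b \<noteq> a \<Longrightarrow> c \<noteq> a \<Longrightarrow> b \<noteq> c \<Longrightarrow>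
      kn_index n (star_plus_edge V a b c) \<le> kn_index n U"
begin

lemma simple: "simple_graph V U" and conn: "connected_graph V U"
  using U by (auto simp: unicyclic_def)

lemma finite_V: "finite V"
  using V finite_subset by blast

lemma no_loop: "{v} \<notin> U"
  using simple_graphD(3)[OF simple] .

lemma edge_in_V: "{u, v} \<in> U \<Longrightarrow> u \<in> V \<and> v \<in> V \<and> u \<noteq> v"
  using simple_graphD(4)[OF simple] .

lemma obtain_cycle:
  obtains C where "C \<subseteq> U" "is_cycle C"
  using U by (auto simp: unicyclic_def)

text \<open>The bound 3 is what rules out the 4-cycle later on.\<close>

lemma kn_index_gt: "kn_index n U > 3"
proof -
  obtain C where C: "C \<subseteq> U" "is_cycle C"
    using obtain_cycle .
  obtain a where a: "a \<in> V"
    using cycle_edge_avoiding_vertex[OF simple C] by blast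
  obtain b c where "b \<noteq> a" "c \<noteq> a" "b \<noteq> c" "b \<in> V" "c \<in> V"
    using cycle_edge_avoiding_vertex[OF simple C, of a] by blast
  then show ?thesis
    using kn_index_star_plus_edge_gt[OF n V a] extremal[OF a] by fastforce
qed

text \<open>The form of \<open>U\<close> at \<open>x\<close> is at most that of the star plus edge
  at \<open>y\<close>, hence at most the index of the latter times the common squared norm.
  Extremality bounds this by the form of \<open>U\<close> at \<open>x\<close> again, so equality
  holds throughout.\<close>

lemma star_plus_edge_eigvec:
  assumes abc: "a \<in> V" "b \<in> V" "c \<in> V" "b \<noteq> a" "c \<noteq> a" "b \<noteq> c"
    and ev: "is_eigvec n U (kn_index n U) x"
    and norm: "(\<Sum>i<n. (y i)\<^sup>2) = (\<Sum>i<n. (x i)\<^sup>2)"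
    and le: "quad_form n (signed_entry U) x \<le> quad_form n (signed_entry (star_plus_edge V a b c)) y"
  shows "quad_form n (signed_entry U) x = quad_form n (signed_entry (star_plus_edge V a b c)) y"
    and "is_eigvec n (star_plus_edge V a b c) (kn_index n U) y"
proof -
  let ?H = "star_plus_edge V a b c" and ?s = "\<Sum>i<n. (x i)\<^sup>2"
  have s: "?s > 0"
    using ev sum_squares_pos[of _ n x] by (auto simp: is_eigvec_def)
  have U1: "quad_form n (signed_entry U) x = kn_index n U * ?s"
    using ev quad_form_eigenvector[of n "signed_entry U" x] by (simp add: is_eigvec_def)
  have H1: "quad_form n (signed_entry ?H) y \<le> kn_index n ?H * ?s"
    using quad_form_le_kn_index[of n ?H y] n norm by simp
  have H2: "kn_index n ?H * ?s \<le> kn_index n U * ?s"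
    using extremal[OF abc] s by simp
  show "quad_form n (signed_entry U) x = quad_form n (signed_entry ?H) y"
    using U1 H1 H2 le by linarith
  have "kn_index n ?H * ?s = kn_index n U * ?s"
    using U1 H1 H2 le by linarith
  then have eq: "kn_index n ?H = kn_index n U"
    using s by simp
  have "\<exists>i<n. y i \<noteq> 0"
  proof (rule ccontr)
    assume "\<not> (\<exists>i<n. y i \<noteq> 0)"
    then have "(\<Sum>i<n. (y i)\<^sup>2) = 0" by simp
    then show False using norm s by simp
  qed
  moreover have "quad_form n (signed_entry ?H) y = kn_index n ?H * (\<Sum>i<n. (y i)\<^sup>2)"
    unfolding norm using U1 H1 H2 le by linarith
  ultimately have "is_eigvec n ?H (kn_index n ?H) y"
    by (intro quad_form_eq_kn_index_imp_eigvec)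
  then show "is_eigvec n ?H (kn_index n U) y"
    by (simp add: eq)
qed

section \<open>Vectors with at most one negative entry\<close>

text \<open>A spanning forest of \<open>U\<close> weighs at least as much as the full star at
  \<open>a\<close>, and the edges left over have nonnegative weight. Keeping one of them gives a
  star plus edge with total weight no larger than that of \<open>U\<close>, so \<open>x\<close> is
  an eigenvector of it too. Comparing the equations at \<open>a\<close> shows that \<open>a\<close>
  is adjacent to all of \<open>V\<close>.\<close>

lemma iso_if_min_vertex:
  assumes ev: "is_eigvec n U (kn_index n U) x" and a: "a \<in> V"
    and nn: "\<And>v. v < n \<Longrightarrow> v \<noteq> a \<Longrightarrow> 0 \<le> x v" and min: "\<And>v. v \<in> V \<Longrightarrow> x a \<le> x v"
  shows "graph_iso V U {..<card V} (triangle_pendants (card V))"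
proof -
  have an: "a < n"
    using a V by auto
  obtain F where F: "F \<subseteq> U" "\<And>e. e \<in> U \<Longrightarrow> a \<in> e \<Longrightarrow> e \<in> F" "\<And>C. C \<subseteq> F \<Longrightarrow> \<not> is_cycle C"
    "x a * (\<Sum>v\<in>V - {a}. x v) \<le> (\<Sum>e\<in>F. prod x e)"
    by (rule spanning_forest_weight[OF simple conn a, of x]) (use nn min V in auto)
  obtain C where C: "C \<subseteq> U" "is_cycle C"
    using obtain_cycle .
  \<comment> \<open>\<open>U\<close> has a cycle and \<open>F\<close> has none. As \<open>F\<close>
    has all edges at \<open>a\<close>, an edge outside \<open>F\<close> avoids
    \<open>a\<close>.\<close>
  then obtain e where e: "e \<in> U" "e \<notin> F"
    using F(3)[of C] by blast
  then obtain b c where bc: "e = {b, c}" "b \<in> V" "c \<in> V" "b \<noteq> c"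
    using simple_graphD(5)[OF simple, of e] by blast
  then have d: "b \<noteq> a" "c \<noteq> a"
    using F(2)[of e] e by auto
  let ?H = "star_plus_edge V a b c"
  have finU: "finite U"
    using simple_graphD(2)[OF simple] .
  have "prod x f \<ge> 0" if "f \<in> U - F" for f
  proof (rule prod_nonneg)
    fix v assume "v \<in> f"
    then have "v \<noteq> a" "v \<in> V"
      using that F(2)[of f] simple_graphD(5)[OF simple, of f] by auto
    then show "0 \<le> x v"
      using nn V by auto
  qed
  then have "prod x e \<le> (\<Sum>f\<in>U - F. prod x f)"
    using e finU by (intro member_le_sum) auto
  moreover have "(\<Sum>f\<in>U. prod x f) = (\<Sum>f\<in>U - F. prod x f) + (\<Sum>f\<in>F. prod x f)"
    using sum.subset_diff[OF F(1) finU] .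
  moreover have "prod x e = x b * x c"
    using bc by simp
  ultimately have "(\<Sum>f\<in>?H. prod x f) \<le> (\<Sum>f\<in>U. prod x f)"
    using F(4) sum_prod_star_plus_edge[OF finite_V d bc(4), of x] by linarith
  moreover have H: "simple_graph V ?H"
    using unicyclic_star_plus_edge[OF finite_V a bc(2,3) d bc(4)] by (simp add: unicyclic_def)
  ultimately have "quad_form n (signed_entry U) x \<le> quad_form n (signed_entry ?H) x"
    using quad_form_signed_entry[OF simple V, of x] quad_form_signed_entry[OF H V, of x] by linarith
  from star_plus_edge_eigvec(2)[OF a bc(2,3) d bc(4) ev refl this]
  have evH: "is_eigvec n ?H (kn_index n U) x" .
  \<comment> \<open>The left-hand sides and the total sums agree, so the entries at the
    non-neighbours of \<open>a\<close> in \<open>V\<close> sum to 0.\<close>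
  have "(\<Sum>j | j < n \<and> {a, j} \<in> U. x j) = (\<Sum>j | j < n \<and> {a, j} \<in> ?H. x j)"
    using eigvec_row[OF ev an no_loop] eigvec_row[OF evH an simple_graphD(3)[OF H]] by linarith
  moreover have "{j. j < n \<and> {a, j} \<in> ?H} = V - {a}"
    using V d by (auto simp: doubleton_in_star_plus_edge[OF d bc(4)])
  moreover have sub: "{j. j < n \<and> {a, j} \<in> U} \<subseteq> V - {a}"
    using edge_in_V by blast
  ultimately have 0: "(\<Sum>j\<in>V - {a} - {j. j < n \<and> {a, j} \<in> U}. x j) = 0"
    using sum.subset_diff[OF sub, of x] finite_V by simp
  have "{a, v} \<in> U" if v: "v \<in> V" "v \<noteq> a" for v
  proof (rule ccontr)
    assume "{a, v} \<notin> U"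
    moreover have "\<forall>j\<in>V - {a} - {j. j < n \<and> {a, j} \<in> U}. x j = 0"
      using 0 by (subst (asm) sum_nonneg_eq_0_iff) (use nn V finite_V in auto)
    ultimately have v0: "x v = 0"
      using v by blast
    \<comment> \<open>A zero entry makes the minimum \<open>x a\<close> nonpositive, and then all
      entries on \<open>V - {a}\<close> would be positive.\<close>
    moreover have "x a \<le> 0"
      using min[OF v(1)] v0 by simp
    ultimately show False
      using star_plus_edge_eigvec_pos[OF V a bc(2,3) d bc(4) evH _ _ nn v] kn_index_gt by simp
  qed
  then show ?thesis
    by (intro unicyclic_dominating_vertex_iso[OF U refl a])
qed

text \<open>The negative vertex of \<open>V\<close>, if there is one, is the minimizer
  \<open>a\<close>, so all other entries are nonnegative.\<close>

lemma iso_if_few_negative: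
  assumes ev: "is_eigvec n U (kn_index n U) x"
    and out: "\<And>v. v < n \<Longrightarrow> v \<notin> V \<Longrightarrow> 0 \<le> x v" and N: "card {v\<in>V. x v < 0} \<le> 1"
  shows "graph_iso V U {..<card V} (triangle_pendants (card V))"
proof -
  have ne: "V \<noteq> {}"
    using obtain_cycle cycle_edge_avoiding_vertex[OF simple] by (metis empty_iff)
  define a where "a = arg_min_on x V"
  have a: "a \<in> V" "\<And>v. v \<in> V \<Longrightarrow> x a \<le> x v"
    using arg_min_if_finite[OF finite_V ne, of x] by (auto simp: a_def not_less[symmetric])
  have "0 \<le> x v" if v: "v < n" "v \<noteq> a" for v
  proof (rule ccontr)
    assume neg: "\<not> 0 \<le> x v"
    then have "v \<in> V"
      using out v by blast
    then have "{a, v} \<subseteq> {v\<in>V. x v < 0}"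
      using a neg by fastforce
    then have "card {a, v} \<le> card {v\<in>V. x v < 0}"
      using finite_V by (intro card_mono) auto
    then show False
      using N v by simp
  qed
  then show ?thesis
    using iso_if_min_vertex[OF ev a(1)] a(2) by blast
qed

text \<open>Replacing \<open>x\<close> by \<open>|x|\<close> with a minus sign kept only at \<open>a\<close> does not decrease any term of
  the quadratic form, because the only terms which stay negative, those at \<open>{a, w}\<close> with
  \<open>w \<notin> V\<close> and at \<open>{b, c}\<close>, were negative before.\<close>

lemma bipartite_up_to_one_edge:
  assumes ev: "is_eigvec n U (kn_index n U) x"
    and out: "\<And>v. v < n \<Longrightarrow> v \<notin> V \<Longrightarrow> 0 \<le> x v"
    and a: "a \<in> V" "x a < 0" and a': "a' \<in> V" "x a' < 0" "a' \<noteq> a"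
    and bc: "b \<in> V" "c \<in> V" "b \<noteq> a" "c \<noteq> a" "b \<noteq> c"
    and neg: "{b, c} \<in> U \<longleftrightarrow> (x b < 0 \<longleftrightarrow> x c < 0)"
  shows "V = {..<n}"
    and "\<And>u v. u \<in> V \<Longrightarrow> v \<in> V \<Longrightarrow> u \<noteq> v \<Longrightarrow> {u, v} \<noteq> {b, c} \<Longrightarrow> {u, v} \<in> U \<longleftrightarrow> (x u < 0) \<noteq> (x v < 0)"
proof -
  let ?H = "star_plus_edge V a b c"
  define y where "y v = (if v = a then - \<bar>x v\<bar> else \<bar>x v\<bar>)" for v
  have lt: "a < n" "a' < n" "b < n" "c < n"
    using V a a' bc by auto
  have bound: "signed_entry U i j * x i * x j \<le> \<bar>x i\<bar> * \<bar>x j\<bar>" for i j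
    using abs_ge_self[of "x i * x j"] abs_ge_minus_self[of "x i * x j"]
    by (auto simp: signed_entry_def abs_mult)
  have at_a: "signed_entry U a j * x a * x j \<le> signed_entry ?H a j * y a * y j" if "j < n" for j
  proof (cases "j = a \<or> j \<in> V")
    case True
    then show ?thesis
      using bound[of a j] by (auto simp: signed_entry_def y_def doubleton_in_star_plus_edge[OF bc(3-5)])
  next
    case False
    then have "{a, j} \<notin> U" "{a, j} \<notin> ?H" "j \<noteq> a" "0 \<le> x j"
      using edge_in_V bc out[OF that] by (auto simp: doubleton_in_star_plus_edge[OF bc(3-5)])
    then show ?thesis
      using a by (simp add: signed_entry_def y_def)
  qed
  have le: "signed_entry U i j * x i * x j \<le> signed_entry ?H i j * y i * y j" if "i < n" "j < n" for i j
  proof -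
    consider "i = a" | "j = a" | "i = j" | "i \<noteq> a" "j \<noteq> a" "i \<noteq> j" "{i, j} = {b, c}"
      | "i \<noteq> a" "j \<noteq> a" "i \<noteq> j" "{i, j} \<noteq> {b, c}"
      by blast
    then show ?thesis
    proof cases
      case 1
      then show ?thesis using at_a that by simp
    next
      case 2
      then show ?thesis
        using at_a[OF that(1)] by (simp add: signed_entry_sym[of _ i] mult_ac)
    next
      case 3
      then show ?thesis by (simp add: signed_entry_def)
    next
      case 4
      then have "{i, j} \<in> ?H"
        by (simp add: star_plus_edge_def)
      moreover have "{i, j} \<in> U \<longleftrightarrow> (x i < 0 \<longleftrightarrow> x j < 0)"
        using 4(4) neg by (auto simp: doubleton_eq_iff insert_commute)
      ultimately show ?thesis
        using 4 by (cases "x i < 0"; cases "x j < 0") (simp_all add: signed_entry_def y_def)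
    next
      case 5
      then have "{i, j} \<notin> ?H"
        by (auto simp: doubleton_in_star_plus_edge[OF bc(3-5)])
      then show ?thesis
        using 5 bound[of i j] by (simp add: signed_entry_def y_def)
    qed
  qed
  have norm: "(\<Sum>i<n. (y i)\<^sup>2) = (\<Sum>i<n. (x i)\<^sup>2)"
    by (intro sum.cong) (auto simp: y_def)
  have "quad_form n (signed_entry U) x \<le> quad_form n (signed_entry ?H) y"
    unfolding quad_form_def by (intro sum_mono) (use le in auto)
  note E = star_plus_edge_eigvec[OF a(1) bc ev norm this]
  have eq: "signed_entry U i j * x i * x j = signed_entry ?H i j * y i * y j" if "i < n" "j < n" for i j
    using quad_form_mono_eq[OF le E(1) that] by blast
  have ya: "y a < 0" and y0: "\<And>v. v \<noteq> a \<Longrightarrow> 0 \<le> y v"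
    using a by (auto simp: y_def)
  have "y v > 0" if "v \<in> V" "v \<noteq> a" for v
    using star_plus_edge_eigvec_pos[OF V a(1) bc E(2) _ _ _ that] kn_index_gt ya y0 by simp
  then have x0: "x v \<noteq> 0" if "v \<in> V" for v
    using that a by (cases "v = a") (force simp: y_def)+
  have loopH: "{v} \<notin> ?H" for v
    using doubleton_in_star_plus_edge[OF bc(3-5), of v v V] bc by auto
  show Vn: "V = {..<n}"
  proof (rule ccontr)
    assume "V \<noteq> {..<n}"
    then obtain w where w: "w < n" "w \<notin> V"
      using V by auto
    have outH: "(kn_index n U + 1) * y v = (\<Sum>j<n. y j)" if "v < n" "v \<notin> V" for v
    proof -
      have "{j. j < n \<and> {v, j} \<in> ?H} = {}"
        using that a bc by (auto simp: doubleton_in_star_plus_edge[OF bc(3-5)])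
      then show ?thesis
        using eigvec_row[OF E(2) that(1) loopH] by (simp only: sum.empty mult_zero_right diff_zero)
    qed
    \<comment> \<open>The pair \<open>{a', w}\<close> is positive in both graphs. Its term is
      nonpositive for \<open>x\<close> and nonnegative for \<open>y\<close>, so equality of the
      terms makes it 0.\<close>
    have "{a', w} \<notin> U" "{a', w} \<notin> ?H" "w \<noteq> a" "w \<noteq> a'"
      using w edge_in_V a a' bc by (auto simp: doubleton_in_star_plus_edge[OF bc(3-5)])
    then have "x a' * x w = \<bar>x a'\<bar> * \<bar>x w\<bar>"
      using eq[OF lt(2) w(1)] a' by (simp add: signed_entry_def y_def)
    then have "x w = 0"
      using out[OF w] a' by simp
    then have "y w = 0"
      using a by (auto simp: y_def)
    then have S0: "(\<Sum>j<n. y j) = 0"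
      using outH[OF w] by simp
    then have "y v = 0" if "v < n" "v \<notin> V" for v
      using outH[OF that] kn_index_gt by simp
    then have "(\<Sum>j\<in>V. y j) = (\<Sum>j<n. y j)"
      using V by (intro sum.mono_neutral_left) auto
    then have "(\<Sum>j\<in>V - {a}. y j) = - y a"
      using S0 sum.remove[OF finite_V a(1), of y] by simp
    moreover have "{j. j < n \<and> {a, j} \<in> ?H} = V - {a}"
      using V bc by (auto simp: doubleton_in_star_plus_edge[OF bc(3-5)])
    \<comment> \<open>With total 0 and entries on \<open>V - {a}\<close> summing to
      \<open>- y a\<close>, the equation at \<open>a\<close> would make the index 1.\<close>
    ultimately have "(kn_index n U + 1) * y a = 2 * y a"
      using eigvec_row[OF E(2) lt(1) loopH] S0 by simp
    then show False
      using ya kn_index_gt by simp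
  qed
  fix u v assume uv: "u \<in> V" "v \<in> V" "u \<noteq> v" "{u, v} \<noteq> {b, c}"
  \<comment> \<open>Off \<open>{b, c}\<close> the edges of \<open>H\<close> are those at
    \<open>a\<close>, and their sign cancels that of \<open>y a\<close>.\<close>
  have "signed_entry ?H u v * y u * y v = \<bar>x u\<bar> * \<bar>x v\<bar>"
    using uv by (auto simp: signed_entry_def y_def doubleton_in_star_plus_edge[OF bc(3-5)])
  then have "signed_entry U u v * x u * x v = \<bar>x u\<bar> * \<bar>x v\<bar>"
    using eq[of u v] uv V by auto
  moreover have "\<bar>x u\<bar> * \<bar>x v\<bar> > 0"
    using x0 uv by simp
  ultimately have "signed_entry U u v * x u * x v > 0"
    by simp
  then show "{u, v} \<in> U \<longleftrightarrow> (x u < 0) \<noteq> (x v < 0)"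
    using uv x0[OF uv(1)] x0[OF uv(2)]
    by (cases "{u, v} \<in> U"; cases "x u < 0"; cases "x v < 0")
      (auto simp: signed_entry_def zero_less_mult_iff mult_less_0_iff)
qed

text \<open>Otherwise \<open>U\<close> agrees with the complete bipartite graph between
  \<open>N\<close> and \<open>M\<close> on every pair that misses some vertex of \<open>N\<close>:
  on all pairs if \<open>N\<close> has at least three elements, on all but \<open>{p, q}\<close> if
  \<open>N = {p, q}\<close>. Having exactly one cycle leaves only the 4-cycle, whose equations
  contradict an index above 3.\<close>

lemma frustrated_edge_exists:
  assumes ev: "is_eigvec n U (kn_index n U) x"
    and N: "card {v\<in>V. x v < 0} \<ge> 2" and k: "card V \<ge> 4"
  obtains a b c where "a \<in> V" "x a < 0" "b \<in> V" "c \<in> V" "b \<noteq> a" "c \<noteq> a" "b \<noteq> c"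
    "{b, c} \<in> U \<longleftrightarrow> (x b < 0 \<longleftrightarrow> x c < 0)"
proof (rule ccontr)
  assume none: "\<not> thesis"
  note witness = that
  have K: "{b, c} \<in> U \<longleftrightarrow> (x b < 0) \<noteq> (x c < 0)"
    if "a \<in> V" "x a < 0" "b \<in> V" "c \<in> V" "b \<noteq> a" "c \<noteq> a" "b \<noteq> c" for a b c
    using that none witness[of a b c] by blast
  define N where "N = {v\<in>V. x v < 0}"
  define M where "M = V - N"
  have NV: "N \<subseteq> V" "finite N" "finite M" "N \<inter> M = {}"
    using finite_V by (auto simp: N_def M_def)
  have cV: "card V = card N + card M"
    using NV finite_V by (simp add: M_def card_Diff_subset card_mono)
  show False
  proof (cases "card N \<ge> 3")
    case True
    have bip: "{u, v} \<in> U \<longleftrightarrow> (x u < 0) \<noteq> (x v < 0)" if "u \<in> V" "v \<in> V" "u \<noteq> v" for u v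
    proof -
      have "\<not> N \<subseteq> {u, v}"
        using True card_mono[of "{u, v}" N] that by auto
      then obtain a where "a \<in> N" "a \<noteq> u" "a \<noteq> v" by blast
      then show ?thesis
        using K[of a u v] that by (auto simp: N_def)
    qed
    show False
    proof (cases "card M \<ge> 2")
      case True
      show False
      proof (rule unicyclic_no_K23[OF U, of M N])
        fix u v assume "u \<in> M" "v \<in> N"
        then show "{u, v} \<in> U"
          using bip[of u v] NV(4) by (auto simp: M_def N_def)
      qed (use True \<open>card N \<ge> 3\<close> NV in auto)
    next
      case False
      then obtain m where m: "M \<subseteq> {m}"
        using NV(3) by (metis card_le_Suc0_iff_eq not_less_eq_eq numeral_2_eq_2 singleton_iff subsetI)
      obtain C where C: "C \<subseteq> U" "is_cycle C"
        using obtain_cycle .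
      obtain b c where bc: "{b, c} \<in> C" "b \<noteq> m" "c \<noteq> m" "b \<noteq> c" "b \<in> V" "c \<in> V"
        using cycle_edge_avoiding_vertex[OF simple C, of m] by blast
      then have "b \<in> N" "c \<in> N"
        using m by (auto simp: M_def)
      then show False
        using bip[of b c] bc C by (auto simp: N_def)
    qed
  next
    case False
    then have "card N = 2"
      using N by (simp add: N_def)
    then obtain p q where pq: "N = {p, q}" "p \<noteq> q"
      by (auto simp: card_2_iff)
    have pqV: "p \<in> V" "q \<in> V" "x p < 0" "x q < 0"
      using pq by (auto simp: N_def)
    have bip: "{u, v} \<in> U \<longleftrightarrow> (x u < 0) \<noteq> (x v < 0)" if "u \<in> V" "v \<in> V" "u \<noteq> v" "{u, v} \<noteq> {p, q}" for u v
    proof -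
      have "p \<noteq> u \<and> p \<noteq> v \<or> q \<noteq> u \<and> q \<noteq> v"
        using that(3,4) pq(2) by (auto simp: doubleton_eq_iff)
      then show ?thesis
        using K[of p u v] K[of q u v] that pqV by metis
    qed
    have cross: "{u, v} \<in> U" if "u \<in> N" "v \<in> M" for u v
      using bip[of u v] that pq by (auto simp: M_def N_def doubleton_eq_iff)
    have "card M < 3"
    proof (rule ccontr)
      assume "\<not> card M < 3"
      then show False
        using unicyclic_no_K23[OF U NV(4)] \<open>card N = 2\<close> cross by auto
    qed
    then have "card M = 2"
      using cV k \<open>card N = 2\<close> by simp
    then obtain r s where rs: "M = {r, s}" "r \<noteq> s"
      by (auto simp: card_2_iff)
    have rsV: "r \<in> V" "s \<in> V" "0 \<le> x r" "0 \<le> x s"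
      using rs by (auto simp: M_def N_def)
    have dist: "p \<noteq> r" "p \<noteq> s" "q \<noteq> r" "q \<noteq> s"
      using pqV rsV by auto
    have Vpq: "V = {p, q, r, s}"
      using pq rs NV by (auto simp: M_def)
    have pr: "{p, r} \<in> U" "{p, s} \<in> U" "{q, r} \<in> U" "{q, s} \<in> U"
      using cross pq rs by auto
    have nrs: "{r, s} \<notin> U"
      using bip[of r s] rs rsV dist by (auto simp: doubleton_eq_iff)
    have npq: "{p, q} \<notin> U"
    proof
      assume "{p, q} \<in> U"
      then have "{{p, q}, {q, r}, {p, r}} = {{p, q}, {q, s}, {p, s}}"
        using pr dist pq by (intro unicyclic_cycle_unique[OF U] is_cycle_triangle) auto
      moreover have "{q, r} \<in> {{p, q}, {q, r}, {p, r}}"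
        by simp
      ultimately have "{q, r} \<in> {{p, q}, {q, s}, {p, s}}"
        by (simp only:)
      then show False
        using dist rs pq by (simp add: doubleton_eq_iff)
    qed
    let ?S = "\<Sum>j<n. x j" and ?l = "kn_index n U"
    have nb: "{j. j < n \<and> {p, j} \<in> U} = {r, s}" "{j. j < n \<and> {q, j} \<in> U} = {r, s}"
      "{j. j < n \<and> {r, j} \<in> U} = {p, q}" "{j. j < n \<and> {s, j} \<in> U} = {p, q}"
    proof -
      have "{r, p} \<in> U" "{s, p} \<in> U" "{r, q} \<in> U" "{s, q} \<in> U" "{s, r} \<notin> U" "{q, p} \<notin> U"
        using pr nrs npq by (simp_all add: insert_commute)
      moreover have "v = p \<or> v = q \<or> v = r \<or> v = s" if "{u, v} \<in> U" for u v
        using edge_in_V[OF that] Vpq by blast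
      ultimately show "{j. j < n \<and> {p, j} \<in> U} = {r, s}" "{j. j < n \<and> {q, j} \<in> U} = {r, s}"
        "{j. j < n \<and> {r, j} \<in> U} = {p, q}" "{j. j < n \<and> {s, j} \<in> U} = {p, q}"
        using pr nrs npq V Vpq edge_in_V by blast+
    qed
    have lt: "p < n" "q < n" "r < n" "s < n"
      using V Vpq by auto
    have 1: "(?l + 1) * x p = ?S - 2 * (x r + x s)" "(?l + 1) * x q = ?S - 2 * (x r + x s)"
      "(?l + 1) * x r = ?S - 2 * (x p + x q)" "(?l + 1) * x s = ?S - 2 * (x p + x q)"
      using eigvec_row[OF ev lt(1) no_loop] eigvec_row[OF ev lt(2) no_loop]
        eigvec_row[OF ev lt(3) no_loop] eigvec_row[OF ev lt(4) no_loop] rs pq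
      by (simp_all add: nb)
    have l: "?l > 3"
      by (rule kn_index_gt)
    have "(?l + 1) * x p = (?l + 1) * x q" "(?l + 1) * x r = (?l + 1) * x s"
      using 1 by linarith+
    then have 2: "x p = x q" "x r = x s"
      using l by auto
    \<comment> \<open>The difference of the equations at \<open>p\<close> and \<open>r\<close>. As
      \<open>x p < 0 \<le> x r\<close>, it can only hold for index 3.\<close>
    have "(?l - 3) * (x p - x r) = ((?l + 1) * x p - (?l + 1) * x r) - 4 * (x p - x r)"
      by (simp add: algebra_simps)
    also have "\<dots> = 0"
      using 1 2 by simp
    finally show False
      using l pqV rsV by simp
  qed
qed

lemma iso_triangle_pendants: "graph_iso V U {..<card V} (triangle_pendants (card V))"
proof -
  obtain x0 where ev0: "is_eigvec n U (kn_index n U) x0"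
    using kn_index_attained[of n U] n by auto
  \<comment> \<open>With nonnegative total, the equation at a vertex outside \<open>V\<close> makes
    its entry nonnegative.\<close>
  define x where "x = (if (\<Sum>j<n. x0 j) \<ge> 0 then x0 else (\<lambda>i. - x0 i))"
  have ev: "is_eigvec n U (kn_index n U) x"
    using ev0 eigvec_uminus[OF ev0] by (simp add: x_def)
  have S: "(\<Sum>j<n. x j) \<ge> 0"
    by (auto simp: x_def sum_negf)
  have out: "0 \<le> x v" if "v < n" "v \<notin> V" for v
  proof -
    have "{j. j < n \<and> {v, j} \<in> U} = {}"
      using edge_in_V that by blast
    then have "(kn_index n U + 1) * x v = (\<Sum>j<n. x j)"
      using eigvec_row[OF ev that(1) no_loop] by (simp only: sum.empty mult_zero_right diff_zero)
    then have "0 \<le> (kn_index n U + 1) * x v"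
      using S by (simp only:)
    then show ?thesis
      using kn_index_gt by (simp add: zero_le_mult_iff)
  qed
  define N where "N = {v\<in>V. x v < 0}"
  have fN: "finite N" "N \<subseteq> V"
    using finite_V by (auto simp: N_def)
  obtain C where C: "C \<subseteq> U" "is_cycle C"
    using obtain_cycle .
  consider "card N \<le> 1" | "card V \<le> 3" | "card N \<ge> 2" "card V \<ge> 4"
    by linarith
  then show ?thesis
  proof cases
    case 1
    then show ?thesis
      using iso_if_few_negative[OF ev out] by (simp add: N_def)
  next
    case 2
    obtain a where a: "a \<in> V"
      using cycle_edge_avoiding_vertex[OF simple C] by blast
    obtain b c where "b \<noteq> a" "c \<noteq> a" "b \<noteq> c" "b \<in> V" "c \<in> V"
      using cycle_edge_avoiding_vertex[OF simple C, of a] by blast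
    then have "card {a, b, c} = 3" "{a, b, c} \<subseteq> V"
      using a by auto
    then have "card V = 3"
      using 2 card_mono[OF finite_V, of "{a, b, c}"] by simp
    then show ?thesis
      using unicyclic_three_vertices_iso[OF U] by simp
  next
    case 3
    obtain a b c where abc: "a \<in> V" "x a < 0" "b \<in> V" "c \<in> V" "b \<noteq> a" "c \<noteq> a" "b \<noteq> c"
      "{b, c} \<in> U \<longleftrightarrow> (x b < 0 \<longleftrightarrow> x c < 0)"
      using frustrated_edge_exists[OF ev] 3 by (auto simp: N_def)
    have "\<not> N \<subseteq> {a}"
      using 3 card_mono[of "{a}" N] by auto
    then obtain a' where a': "a' \<in> V" "x a' < 0" "a' \<noteq> a"
      by (auto simp: N_def)
    note B = bipartite_up_to_one_edge[OF ev out abc(1,2) a' abc(3-8)]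
    \<comment> \<open>Otherwise both parts have at least two vertices, together
      \<open>n > 5\<close>, and only the pair \<open>{b, c}\<close> can be missing between them,
      which is too much for a single cycle.\<close>
    have "card (V - N) \<le> 1"
    proof (rule ccontr)
      assume "\<not> card (V - N) \<le> 1"
      moreover have "card N + card (V - N) = n"
        using B(1) fN finite_V by (metis Diff_disjoint Un_Diff_cancel card_Un_disjoint card_lessThan
          finite_Diff sup.absorb2)
      moreover have "{u, v} \<in> U" if "u \<in> N" "v \<in> V - N" "{u, v} \<noteq> {b, c}" for u v
        using B(2)[of u v] that by (auto simp: N_def)
      ultimately show False
        using 3 n fN finite_V unicyclic_no_K23_minus[OF U, of N "V - N" b c] by auto
    qed
    moreover have "card {v\<in>V. - x v < 0} \<le> card (V - N)"
      using finite_V by (intro card_mono) (auto simp: N_def)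
    \<comment> \<open>After the change of sign only the vertices of \<open>V - N\<close> can be
      negative, and nonnegativity outside \<open>V = {..<n}\<close> is vacuous.\<close>
    ultimately show ?thesis
      using iso_if_few_negative[OF eigvec_uminus[OF ev]] B(1) by auto
  qed
qed

end

theorem theorem3p6:
  fixes n k :: nat and V :: "nat set" and U :: "nat set set"
  assumes "n > 5" and "3 \<le> k" and "k \<le> n"
    and "subgraph_Kn n V U" and "card V = k" and "unicyclic V U"
    and "\<forall>V' U'. subgraph_Kn n V' U' \<and> card V' = k \<and> unicyclic V' U' \<longrightarrow>
           index (signed_Kn_adj n U') \<le> index (signed_Kn_adj n U)"
  shows "graph_iso V U {..<k} (triangle_pendants k)"
proof -
  have V: "V \<subseteq> {..<n}" "finite V"
    using assms(4) by (auto simp: subgraph_Kn_def simple_graph_def)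
  \<comment> \<open>The competitors keep the vertex set \<open>V\<close>, hence have
    \<open>k\<close> vertices and fall under the maximality assumption.\<close>
  interpret extremal_unicyclic n V U
  proof
    fix a b c assume "a \<in> V" "b \<in> V" "c \<in> V" "b \<noteq> a" "c \<noteq> a" "b \<noteq> c"
    then have "unicyclic V (star_plus_edge V a b c)"
      using V by (intro unicyclic_star_plus_edge)
    moreover from this have "subgraph_Kn n V (star_plus_edge V a b c)"
      using V by (simp add: subgraph_Kn_def unicyclic_def)
    ultimately show "kn_index n (star_plus_edge V a b c) \<le> kn_index n U"
      using assms(5,7) by blast
  qed (use assms V in auto)
  show ?thesis
    using iso_triangle_pendants assms(5) by simp
qed

end
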